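(* Let $D\subset\mathbb{C}^n$ be a $k$-balanced pseudoconvex domain, where $k=(k_1,\ldots,k_n)$ with integers $k_1,\ldots,k_n\ge 1$, and let $f:\mathbb{D}\to D$ be a $3$-geodesic. Assume that $f=(m_\alpha^{k_1}\varphi_1,\ldots,m_\alpha^{k_n}\varphi_n)$, where $\varphi_j$ are holomorphic functions on $\mathbb{D}$ and $\alpha\in\mathbb{D}$. Then either $\varphi:=(\varphi_1,\ldots,\varphi_n)$ is a $2$-geodesic of $D$ or $\varphi(\mathbb{D})\subset\partial D$. If $f$ is additionally a $2$-geodesic, then $\varphi(\mathbb{D})\subset\partial D$.
   Context: $\mathbb{D}$ is the open unit disc in $\mathbb{C}$ and $m_\alpha(\lambda)=\frac{\lambda-\alpha}{1-\overline{\alpha}\lambda}$ for $\alpha\in\mathbb{D}$. A domain $D\subset\mathbb{C}^n$ is $k$-balanced if $\lambda\in\overline{\mathbb{D}}$, $z\in D$ imply $(\lambda^{k_1}z_1,\ldots,\lambda^{k_n}z_n)\in D$. A finite Blaschke product of degree $s\in\{0,1,2,\ldots\}$ is a function $\zeta\prod_{j=1}^s m_{\alpha_j}$ with $|\zeta|=1$, $\alpha_j\in\mathbb{D}$. For an integer $l\ge 2$, a holomorphic mapping $f:\mathbb{D}\to D$ is an $l$-geodesic (of $D$) if there is a holomorphic $F:D\to\mathbb{D}$ such that $F\circ f$ is a non-constant Blaschke product of degree at most $l-1$. *)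

theory Defs
  imports "HOL-Complex_Analysis.Complex_Analysis"
begin

text \<open>The disc automorphism \<open>m\<^sub>\<alpha>\<close> is the library's \<^term>\<open>Moebius_function 0 \<alpha>\<close>.\<close>

definition domain_Cn :: "(complex ^ 'n) set \<Rightarrow> bool" where
  "domain_Cn D \<longleftrightarrow> open D \<and> connected D \<and> D \<noteq> {}"

definition k_balanced :: "('n \<Rightarrow> nat) \<Rightarrow> (complex ^ 'n) set \<Rightarrow> bool" where
  "k_balanced k D \<longleftrightarrow>
     (\<forall>\<mu>\<in>cball 0 1. \<forall>z\<in>D. (\<chi> i. \<mu> ^ k i * z $ i) \<in> D)"

text \<open>The sub-mean value inequality is required on every closed affine complex disc contained
  in \<open>D\<close>. Since \<open>u\<close> is real-valued and continuous, the integral exists; discontinuous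
  functions and the value \<open>-\<infinity>\<close> are not needed here.\<close>

definition continuous_plurisubharmonic_on ::
    "(complex ^ 'n \<Rightarrow> real) \<Rightarrow> (complex ^ 'n) set \<Rightarrow> bool" where
  "continuous_plurisubharmonic_on u D \<longleftrightarrow>
     continuous_on D u \<and>
     (\<forall>z\<in>D. \<forall>w. (\<forall>\<mu>\<in>cball 0 1. z + \<mu> *s w \<in> D) \<longrightarrow>
        u z \<le> integral {0..2 * pi} (\<lambda>t. u (z + cis t *s w)) / (2 * pi))"

text \<open>Pseudoconvexity of an open set: existence of a continuous plurisubharmonic exhaustion
  function.\<close>

definition pseudoconvex :: "(complex ^ 'n) set \<Rightarrow> bool" where
  "pseudoconvex D \<longleftrightarrow> open D \<and>
     (\<exists>u. continuous_plurisubharmonic_on u D \<and> (\<forall>c. compact {z \<in> D. u z \<le> c}))"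

text \<open>Holomorphy in several variables: the real Frechet derivative exists and is
  complex-linear at every point of the (open) set.\<close>

definition holomorphic_fun_on ::
    "(complex ^ 'n \<Rightarrow> complex) \<Rightarrow> (complex ^ 'n) set \<Rightarrow> bool" where
  "holomorphic_fun_on F D \<longleftrightarrow>
     (\<forall>z\<in>D. \<exists>F'. (F has_derivative F') (at z) \<and> (\<forall>c v. F' (c *s v) = c * F' v))"

definition holomorphic_curve_on :: "(complex \<Rightarrow> complex ^ 'n) \<Rightarrow> complex set \<Rightarrow> bool" where
  "holomorphic_curve_on f U \<longleftrightarrow> (\<forall>i. (\<lambda>z. f z $ i) holomorphic_on U)"

text \<open>Functions on the unit disc are total functions here; values outside the disc are
  irrelevant.\<close>

definition finite_Blaschke_product :: "nat \<Rightarrow> (complex \<Rightarrow> complex) \<Rightarrow> bool" where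
  "finite_Blaschke_product s B \<longleftrightarrow>
     (\<exists>\<zeta> \<alpha>. norm \<zeta> = 1 \<and> (\<forall>j<s. \<alpha> j \<in> ball 0 1) \<and>
        (\<forall>z\<in>ball 0 1. B z = \<zeta> * (\<Prod>j<s. Moebius_function 0 (\<alpha> j) z)))"

definition l_geodesic :: "nat \<Rightarrow> (complex ^ 'n) set \<Rightarrow> (complex \<Rightarrow> complex ^ 'n) \<Rightarrow> bool" where
  "l_geodesic l D f \<longleftrightarrow>
     l \<ge> 2 \<and>
     holomorphic_curve_on f (ball 0 1) \<and> f ` ball 0 1 \<subseteq> D \<and>
     (\<exists>F. holomorphic_fun_on F D \<and> F ` D \<subseteq> ball 0 1 \<and>
        \<not> (F \<circ> f) constant_on ball 0 1 \<and>
        (\<exists>s\<le>l - 1. finite_Blaschke_product s (F \<circ> f)))"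

end

theory Submission
  imports Defs
begin

text \<open>
  Write \<open>\<lambda>\<cdot>z = (\<lambda>^k\<^sub>1 z\<^sub>1, \<dots>, \<lambda>^k\<^sub>n z\<^sub>n)\<close>, so that \<open>f = m\<^sub>\<alpha>\<cdot>\<phi>\<close>. Every holomorphic disc with boundary in \<open>D\<close> lies
  in \<open>D\<close>: contract it to the origin by \<open>t\<cdot>\<psi>\<close> with \<open>0 \<le> t \<le> 1\<close>; the exhaustion function stays
  bounded along the way by the maximum principle. Applied to \<open>s\<cdot>\<phi>\<close> on circles where \<open>\<bar>m\<^sub>\<alpha>\<bar> \<ge> s\<close>
  this gives \<open>\<phi>(ball 0 1) \<subseteq> closure D\<close>, and a Hopf-type barrier shows that \<open>\<phi>\<close> cannot both meet \<open>D\<close> and leave it.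

  Suppose \<open>\<phi>(ball 0 1) \<subseteq> D\<close> and \<open>F \<circ> f = B\<close>. After a Moebius normalisation, \<open>F 0 = 0\<close> and
  \<open>B = m\<^sub>\<alpha> B\<^sub>1\<close> with \<open>deg B\<^sub>1 < deg B\<close>. The function \<open>H(\<lambda>, z) = F(\<lambda>\<cdot>z) / \<lambda>\<close> satisfies
  \<open>\<bar>H(\<cdot>, z)\<bar> \<le> r(z) < 1\<close> by the Schwarz lemma, as \<open>\<lambda>\<cdot>z\<close> stays in a compact subset of \<open>D\<close>, while
  \<open>H(m\<^sub>\<alpha>(\<zeta>), \<phi>(\<zeta>)) = B\<^sub>1(\<zeta>)\<close>. Hence \<open>B\<^sub>1\<close> is not a unimodular constant. If it is an automorphism,
  the unique fixed point \<open>G z\<close> of the contraction \<open>m\<^sub>\<alpha> \<circ> B\<^sub>1\<^sup>-\<^sup>1 \<circ> H(\<cdot>, z)\<close> depends holomorphically on \<open>z\<close>,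
  and \<open>G \<circ> \<phi> = m\<^sub>\<alpha>\<close>.
\<close>

unbundle no fps_syntax

subsection \<open>The maximum principle on analytic discs\<close>

text \<open>Cauchy's formula at the centre; in the maximum principle it makes the holomorphic error
  term average to its central value.\<close>

lemma holomorphic_circle_mean:
  fixes E :: "complex \<Rightarrow> complex"
  assumes "E holomorphic_on cball 0 r" and r: "r > 0"
  shows "((\<lambda>t. E (of_real r * cis t)) has_integral 2 * pi * E 0) {0..2 * pi}"
proof -
  have "((\<lambda>u. E u / (u - 0)) has_contour_integral 2 * of_real pi * \<i> * E 0) (circlepath 0 r)"
    by (rule Cauchy_integral_circlepath_simple) (use assms in auto)
  then have "((\<lambda>t. E (of_real r * cis t) / (of_real r * cis t) * of_real r * \<i> * cis t) has_integral
      2 * of_real pi * \<i> * E 0) {0..2 * pi}"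
    unfolding circlepath_def using has_contour_integral_part_circlepath_iff[of 0 "2 * pi"] by simp
  then have "((\<lambda>t. E (of_real r * cis t) * \<i>) has_integral 2 * of_real pi * \<i> * E 0) {0..2 * pi}"
    using r by (simp add: field_simps)
  from has_integral_mult_right[OF this, of "- \<i>"] show ?thesis
    by (simp add: algebra_simps)
qed

lemma continuous_plurisubharmonic_onD:
  assumes "continuous_plurisubharmonic_on u D" "z \<in> D" "\<And>\<mu>. norm \<mu> \<le> 1 \<Longrightarrow> z + \<mu> *s w \<in> D"
  shows "2 * pi * u z \<le> integral {0..2 * pi} (\<lambda>t. u (z + cis t *s w))"
    and "(\<lambda>t. u (z + cis t *s w)) integrable_on {0..2 * pi}"
proof -
  have "u z \<le> integral {0..2 * pi} (\<lambda>t. u (z + cis t *s w)) / (2 * pi)"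
    using assms unfolding continuous_plurisubharmonic_on_def by auto
  then show "2 * pi * u z \<le> integral {0..2 * pi} (\<lambda>t. u (z + cis t *s w))"
    by (simp add: field_simps)
  have "continuous_on {0..2*pi} (\<lambda>t. z + cis t *s w)"
    unfolding vector_scalar_mult_def by (intro continuous_intros)
  then have "continuous_on {0..2*pi} (\<lambda>t. u (z + cis t *s w))"
    by (rule continuous_on_compose2[of D u, rotated])
       (use assms in \<open>simp_all add: continuous_plurisubharmonic_on_def image_subset_iff\<close>)
  then show "(\<lambda>t. u (z + cis t *s w)) integrable_on {0..2 * pi}"
    by (rule integrable_continuous_real)
qed

lemma norm_vec_le_card:
  fixes e :: "'a::real_normed_vector ^ 'n"
  assumes "\<And>i. norm (e $ i) \<le> b"
  shows "norm e \<le> of_nat CARD('n) * b"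
proof -
  have "norm e \<le> (\<Sum>i\<in>UNIV. norm (e $ i))"
    unfolding norm_vec_def by (rule L2_set_le_sum) auto
  also have "\<dots> \<le> of_nat CARD('n) * b"
    using sum_bounded_above[of UNIV "\<lambda>i. norm (e $ i)" b] assms by simp
  finally show ?thesis .
qed

text \<open>The conjugate sits on the first argument, so for fixed \<open>x\<close> the inner
  product is the real part of a complex-linear function of \<open>y\<close>.\<close>

lemma inner_vec_complex: "x \<bullet> y = Re (\<Sum>i\<in>UNIV. cnj (x $ i) * y $ i)" for x y :: "complex ^ 'n"
  by (simp add: inner_vec_def inner_complex_def)

text \<open>This is first-order Taylor approximation. The name refers to its use with a quadratic
  penalty, where the square of the error has the size of a second-order term with small
  coefficient.\<close>

lemma holomorphic_curve_second_order:
  fixes \<gamma> :: "complex \<Rightarrow> complex ^ 'n"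
  assumes "holomorphic_curve_on \<gamma> U" "open U" "\<xi> \<in> U" "\<kappa> > 0"
  defines "v \<equiv> (\<chi> i. deriv (\<lambda>z. \<gamma> z $ i) \<xi>)"
  shows "\<forall>\<^sub>F \<eta> in nhds 0. norm (\<eta> *s v - (\<gamma> (\<xi> + \<eta>) - \<gamma> \<xi>)) \<le> \<kappa> * norm \<eta>"
proof -
  define c where "c = \<kappa> / of_nat CARD('n)"
  have c: "c > 0" using assms by (simp add: c_def)
  have "\<forall>\<^sub>F \<eta> in nhds 0. norm (\<eta> * v $ i - (\<gamma> (\<xi> + \<eta>) $ i - \<gamma> \<xi> $ i)) \<le> c * norm \<eta>" for i
  proof -
    have "((\<lambda>z. \<gamma> z $ i) has_field_derivative v $ i) (at \<xi>)"
      using assms by (auto simp: v_def holomorphic_curve_on_def intro!: holomorphic_derivI)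
    then have "((\<lambda>z. \<gamma> z $ i) has_derivative (\<lambda>\<eta>. v $ i * \<eta>)) (at \<xi>)"
      by (simp add: has_field_derivative_def)
    then obtain d where d: "d > 0" and
      *: "\<And>y. norm (y - \<xi>) < d \<Longrightarrow> norm (\<gamma> y $ i - \<gamma> \<xi> $ i - v $ i * (y - \<xi>)) \<le> c * norm (y - \<xi>)"
      using c unfolding has_derivative_at_alt by meson
    have "norm (\<eta> * v $ i - (\<gamma> (\<xi> + \<eta>) $ i - \<gamma> \<xi> $ i)) \<le> c * norm \<eta>" if "norm \<eta> < d" for \<eta>
      using *[of "\<xi> + \<eta>"] that norm_minus_commute[of "\<eta> * v $ i"]
      by (simp add: mult.commute[of \<eta>])
    then show ?thesis unfolding eventually_nhds_metric
      using d by (intro exI[of _ d]) simp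
  qed
  then have "\<forall>\<^sub>F \<eta> in nhds 0. \<forall>i. norm (\<eta> * v $ i - (\<gamma> (\<xi> + \<eta>) $ i - \<gamma> \<xi> $ i)) \<le> c * norm \<eta>"
    by (rule eventually_all_finite)
  then show ?thesis
  proof eventually_elim
    case (elim \<eta>)
    have "norm (\<eta> *s v - (\<gamma> (\<xi> + \<eta>) - \<gamma> \<xi>)) \<le> of_nat CARD('n) * (c * norm \<eta>)"
      by (rule norm_vec_le_card) (use elim in simp)
    then show ?case by (simp add: c_def)
  qed
qed

text \<open>
  The sub-mean value property is only available on affine discs. So the point of the curve is
  decoupled from the point where \<open>u\<close> is evaluated: maximise
  \<open>u (\<gamma> \<xi> + y) - N \<bar>y\<bar>\<^sup>2 + \<delta> \<bar>\<xi>\<bar>\<^sup>2\<close>. At an interior maximum, moving \<open>\<xi>\<close> on a small circle and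
  \<open>\<gamma> \<xi> + y\<close> along the tangent disc of \<open>\<gamma>\<close>, the penalty changes by a harmonic function up to
  \<open>o(r\<^sup>2)\<close>, whereas \<open>\<delta> \<bar>\<xi>\<bar>\<^sup>2\<close> gains \<open>\<delta> r\<^sup>2\<close> on average.
\<close>

theorem plurisubharmonic_maximum_principle:
  fixes \<gamma> :: "complex \<Rightarrow> complex ^ 'n" and u :: "complex ^ 'n \<Rightarrow> real"
  assumes psh: "continuous_plurisubharmonic_on u D" and D: "open D"
    and cont: "continuous_on (cball 0 1) \<gamma>" and hol: "holomorphic_curve_on \<gamma> (ball 0 1)"
    and sub: "\<gamma> ` cball 0 1 \<subseteq> D"
    and bd: "\<And>\<xi>. norm \<xi> = 1 \<Longrightarrow> u (\<gamma> \<xi>) \<le> m"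
    and \<xi>s: "norm \<xi>s \<le> 1"
  shows "u (\<gamma> \<xi>s) \<le> m"
proof (rule ccontr)
  assume "\<not> u (\<gamma> \<xi>s) \<le> m"
  \<comment> \<open>A quarter of the assumed excess: replacing \<open>\<gamma> \<xi> + y\<close> by
    \<open>\<gamma> \<xi>\<close> costs one \<open>\<delta>\<close>, the term
    \<open>\<delta> * (norm \<xi>)^2\<close> at most another, and a positive margin remains.\<close>
  define \<delta> where "\<delta> = (u (\<gamma> \<xi>s) - m) / 4"
  have \<delta>: "\<delta> > 0" and us: "u (\<gamma> \<xi>s) = m + 4 * \<delta>"
    using \<open>\<not> u (\<gamma> \<xi>s) \<le> m\<close> by (simp_all add: \<delta>_def field_simps)
  have contu: "continuous_on D u"
    using psh by (simp add: continuous_plurisubharmonic_on_def)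
  have "compact (\<gamma> ` cball 0 1)"
    by (rule compact_continuous_image[OF cont compact_cball])
  then obtain \<rho>1 where \<rho>1: "\<rho>1 > 0" and tube: "(\<Union>x\<in>\<gamma> ` cball 0 1. cball x \<rho>1) \<subseteq> D"
    using compact_subset_open_imp_cball_epsilon_subset[OF _ D sub] by blast
  have inD: "\<gamma> \<xi> + y \<in> D" if "norm \<xi> \<le> 1" "norm y \<le> \<rho>1" for \<xi> y
  proof -
    have "\<gamma> \<xi> + y \<in> cball (\<gamma> \<xi>) \<rho>1" using that by (simp add: dist_norm)
    then show ?thesis using that tube by force
  qed
  define U where "U = (\<lambda>(\<xi>, y). u (\<gamma> \<xi> + y))"
  have contU: "continuous_on (cball 0 1 \<times> cball 0 \<rho>1) U"
    unfolding U_def case_prod_unfold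
    by (rule continuous_on_compose2[OF contu])
       (auto intro!: continuous_intros continuous_on_compose2[OF cont] inD)
  then have "uniformly_continuous_on (cball 0 1 \<times> cball 0 \<rho>1) U"
    by (intro compact_uniformly_continuous compact_Times compact_cball)
  then obtain d where d: "d > 0" and
    dU: "\<And>x x'. x \<in> cball 0 1 \<times> cball 0 \<rho>1 \<Longrightarrow> x' \<in> cball 0 1 \<times> cball 0 \<rho>1 \<Longrightarrow> dist x' x < d
       \<Longrightarrow> dist (U x') (U x) < \<delta>"
    unfolding uniformly_continuous_on_def using \<delta> by metis
  define \<rho> where "\<rho> = min (d / 2) \<rho>1"
  have \<rho>: "\<rho> > 0" "\<rho> \<le> \<rho>1" "\<rho> < d" using d \<rho>1 by (auto simp: \<rho>_def)
  have close: "u (\<gamma> \<xi> + y) \<le> u (\<gamma> \<xi>) + \<delta>" if "norm \<xi> \<le> 1" "norm y \<le> \<rho>" for \<xi> y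
    using dU[of "(\<xi>, 0)" "(\<xi>, y)"] that \<rho> by (auto simp: U_def dist_Pair_Pair dist_norm)
  have "compact (u ` \<gamma> ` cball 0 1)"
    by (intro compact_continuous_image continuous_on_subset[OF contu sub] cont compact_cball)
  then obtain M where M: "\<And>\<xi>. norm \<xi> \<le> 1 \<Longrightarrow> u (\<gamma> \<xi>) \<le> M"
    by (force dest!: compact_imp_bounded simp: bounded_iff abs_le_iff)
  \<comment> \<open>The penalty on \<open>norm y = \<rho>\<close> must be at least
    \<open>M - m\<close>, which keeps the maximum away from that sphere.\<close>
  define N where "N = (\<bar>M\<bar> + \<bar>m\<bar> + 1) / \<rho>\<^sup>2"
  have N: "N > 0" "N * \<rho>\<^sup>2 \<ge> M - m" using \<rho> by (auto simp: N_def intro: divide_pos_pos)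
  define \<Psi> where "\<Psi> = (\<lambda>(\<xi>, y). u (\<gamma> \<xi> + y) - N * (norm y)\<^sup>2 + \<delta> * (norm \<xi>)\<^sup>2)"
  have "continuous_on (cball 0 1 \<times> cball 0 \<rho>) U"
    by (rule continuous_on_subset[OF contU]) (use \<rho> in auto)
  then have "continuous_on (cball 0 1 \<times> cball 0 \<rho>) \<Psi>"
    unfolding \<Psi>_def U_def case_prod_unfold by (intro continuous_intros)
  then obtain x0 where "x0 \<in> cball 0 1 \<times> cball 0 \<rho>"
      "\<forall>x\<in>cball 0 1 \<times> cball 0 \<rho>. \<Psi> x \<le> \<Psi> x0"
    using continuous_attains_sup[of "cball (0::complex) 1 \<times> cball (0::complex^'n) \<rho>" \<Psi>] \<rho>
    by (force intro: compact_Times)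
  then obtain \<xi>0 y0 where \<xi>0: "norm \<xi>0 \<le> 1" and y0: "norm y0 \<le> \<rho>"
    and max: "\<And>\<xi> y. norm \<xi> \<le> 1 \<Longrightarrow> norm y \<le> \<rho> \<Longrightarrow> \<Psi> (\<xi>, y) \<le> \<Psi> (\<xi>0, y0)"
    by (cases x0) auto
  have "m + 4 * \<delta> \<le> \<Psi> (\<xi>s, 0)" using us \<delta> by (simp add: \<Psi>_def)
  also have "\<dots> \<le> \<Psi> (\<xi>0, y0)" using max \<xi>s \<rho> by simp
  finally have big: "m + 4 * \<delta> \<le> \<Psi> (\<xi>0, y0)" .
  have "\<delta> * (norm \<xi>0)\<^sup>2 \<le> \<delta> * 1"
    using \<delta> \<xi>0 by (intro mult_left_mono) (auto simp: power_le_one)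
  with close[OF \<xi>0 y0] have small: "\<Psi> (\<xi>0, y0) \<le> u (\<gamma> \<xi>0) + 2 * \<delta> - N * (norm y0)\<^sup>2"
    by (simp add: \<Psi>_def)
  have "norm \<xi>0 \<noteq> 1"
  proof
    assume "norm \<xi>0 = 1"
    moreover have "N * (norm y0)\<^sup>2 \<ge> 0" using N by simp
    ultimately show False using bd[of \<xi>0] small big \<delta> by linarith
  qed
  with \<xi>0 have \<xi>0: "norm \<xi>0 < 1" by simp
  have "norm y0 \<noteq> \<rho>"
  proof
    assume "norm y0 = \<rho>"
    then have "N * (norm y0)\<^sup>2 \<ge> M - m" using N by simp
    then show False using M[of \<xi>0] \<xi>0 small big \<delta> by linarith
  qed
  with y0 have y0: "norm y0 < \<rho>" by simp
  define v where "v = (\<chi> i. deriv (\<lambda>z. \<gamma> z $ i) \<xi>0)"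
  \<comment> \<open>The gap between tangent disc and curve. Shifting \<open>y0\<close> by
    \<open>e \<eta>\<close> makes \<open>\<gamma> (\<xi>0 + \<eta>) + (y0 + e \<eta>)\<close> equal
    to \<open>w + \<eta> *s v\<close>, a point of an affine disc.\<close>
  define e where "e \<eta> = \<eta> *s v - (\<gamma> (\<xi>0 + \<eta>) - \<gamma> \<xi>0)" for \<eta>
  define w where "w = \<gamma> \<xi>0 + y0"
  \<comment> \<open>Chosen so that \<open>N * (norm (e \<eta>))^2\<close> uses up at most half of
    the gain \<open>\<delta> * (norm \<eta>)^2\<close>.\<close>
  define \<kappa> where "\<kappa> = sqrt (\<delta> / (2 * N))"
  have \<kappa>: "\<kappa> > 0" "N * \<kappa>\<^sup>2 = \<delta> / 2" using \<delta> N by (auto simp: \<kappa>_def)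
  have "\<forall>\<^sub>F \<eta> in nhds 0. norm (e \<eta>) \<le> \<kappa> * norm \<eta>"
    unfolding e_def v_def by (rule holomorphic_curve_second_order[OF hol]) (use \<xi>0 \<kappa> in auto)
  moreover have "\<forall>\<^sub>F \<eta> in nhds 0. w + \<eta> *s v \<in> D"
  proof -
    have "continuous_on UNIV (\<lambda>\<eta>. w + \<eta> *s v)"
      unfolding vector_scalar_mult_def by (intro continuous_intros)
    then have "open ((\<lambda>\<eta>. w + \<eta> *s v) -` D)" by (rule open_vimage[OF D])
    moreover have "w \<in> D" using inD[of \<xi>0 y0] \<xi>0 y0 \<rho> by (simp add: w_def)
    ultimately show ?thesis
      using eventually_nhds_in_open[of "(\<lambda>\<eta>. w + \<eta> *s v) -` D" 0] by simp
  qed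
  moreover have "\<forall>\<^sub>F \<eta> in nhds 0. norm (\<xi>0 + \<eta>) < 1 \<and> \<kappa> * norm \<eta> < \<rho> - norm y0"
  proof -
    have "((\<lambda>\<eta>. norm (\<xi>0 + \<eta>)) \<longlongrightarrow> norm (\<xi>0 + 0)) (nhds 0)" "((\<lambda>\<eta>::complex. \<kappa> * norm \<eta>) \<longlongrightarrow> \<kappa> * norm (0::complex)) (nhds 0)"
      by (intro tendsto_intros filterlim_ident)+
    then show ?thesis
      using order_tendstoD(2)[of "\<lambda>\<eta>. norm (\<xi>0 + \<eta>)" "norm (\<xi>0 + 0)" "nhds 0" 1]
        order_tendstoD(2)[of "\<lambda>\<eta>. \<kappa> * norm \<eta>" "\<kappa> * norm (0::complex)" "nhds 0" "\<rho> - norm y0"] \<xi>0 y0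
      by (intro eventually_conj) auto
  qed
  ultimately have "\<forall>\<^sub>F \<eta> in nhds 0. norm (e \<eta>) \<le> \<kappa> * norm \<eta> \<and> w + \<eta> *s v \<in> D \<and>
      norm (\<xi>0 + \<eta>) < 1 \<and> \<kappa> * norm \<eta> < \<rho> - norm y0"
    by eventually_elim auto
  then obtain R where R: "R > 0" and near: "\<And>\<eta>. norm \<eta> < R \<Longrightarrow> norm (e \<eta>) \<le> \<kappa> * norm \<eta> \<and> w + \<eta> *s v \<in> D \<and>
      norm (\<xi>0 + \<eta>) < 1 \<and> \<kappa> * norm \<eta> < \<rho> - norm y0"
    by (auto simp: eventually_nhds_metric)
  define r where "r = R / 2"
  have r: "r > 0" "r < R" using R by (auto simp: r_def)
  \<comment> \<open>The real part of \<open>E\<close> collects the cross terms of the two squared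
    norms. Since \<open>E\<close> is holomorphic with \<open>E 0 = 0\<close>, these terms have mean
    zero on circles.\<close>
  define E where "E \<eta> = 2 * of_real N * (\<Sum>i\<in>UNIV. cnj (y0 $ i) * e \<eta> $ i) - 2 * of_real \<delta> * cnj \<xi>0 * \<eta>" for \<eta>
  have E: "E holomorphic_on cball 0 r"
  proof -
    have "(\<lambda>\<eta>. \<gamma> (\<xi>0 + \<eta>) $ i) holomorphic_on cball 0 r" for i
    proof -
      have "(\<lambda>z. \<gamma> z $ i) \<circ> (\<lambda>\<eta>. \<xi>0 + \<eta>) holomorphic_on cball 0 r"
      proof (rule holomorphic_on_compose_gen[of _ _ _ "ball 0 1"])
        show "(\<lambda>z. \<gamma> z $ i) holomorphic_on ball 0 1" using hol by (simp add: holomorphic_curve_on_def)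
        show "(\<lambda>\<eta>. \<xi>0 + \<eta>) ` cball 0 r \<subseteq> ball 0 1" using near r by force
      qed (intro holomorphic_intros)
      then show ?thesis by (simp add: o_def)
    qed
    then show ?thesis unfolding E_def e_def by (auto intro!: holomorphic_intros)
  qed
  have E0: "E 0 = 0" by (simp add: E_def e_def)
  have le: "u (w + \<eta> *s v) \<le> u w + Re (E \<eta>) - \<delta> / 2 * (norm \<eta>)\<^sup>2" if "norm \<eta> < R" for \<eta>
  proof -
    have eta: "norm (e \<eta>) \<le> \<kappa> * norm \<eta>" "norm (\<xi>0 + \<eta>) < 1" "\<kappa> * norm \<eta> < \<rho> - norm y0"
      using near[OF that] by auto
    have "norm (y0 + e \<eta>) \<le> \<rho>"
      using eta norm_triangle_ineq[of y0 "e \<eta>"] by linarith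
    with eta have "\<Psi> (\<xi>0 + \<eta>, y0 + e \<eta>) \<le> \<Psi> (\<xi>0, y0)" by (intro max) auto
    moreover have "\<gamma> (\<xi>0 + \<eta>) + (y0 + e \<eta>) = w + \<eta> *s v" by (simp add: e_def w_def)
    ultimately have *: "u (w + \<eta> *s v) \<le> u w + N * ((norm (y0 + e \<eta>))\<^sup>2 - (norm y0)\<^sup>2)
        - \<delta> * ((norm (\<xi>0 + \<eta>))\<^sup>2 - (norm \<xi>0)\<^sup>2)"
      by (simp add: \<Psi>_def w_def algebra_simps)
    have n1: "(norm (y0 + e \<eta>))\<^sup>2 - (norm y0)\<^sup>2 = 2 * (y0 \<bullet> e \<eta>) + (norm (e \<eta>))\<^sup>2"
      by (simp add: power2_norm_eq_inner algebra_simps inner_commute)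
    have n2: "(norm (\<xi>0 + \<eta>))\<^sup>2 - (norm \<xi>0)\<^sup>2 = 2 * (\<xi>0 \<bullet> \<eta>) + (norm \<eta>)\<^sup>2"
      by (simp add: power2_norm_eq_inner algebra_simps inner_commute)
    have "Re (E \<eta>) = 2 * N * (y0 \<bullet> e \<eta>) - 2 * \<delta> * (\<xi>0 \<bullet> \<eta>)"
      by (simp add: E_def inner_vec_complex inner_complex_def algebra_simps)
    moreover have "N * (norm (e \<eta>))\<^sup>2 \<le> N * (\<kappa> * norm \<eta>)\<^sup>2"
      using eta(1) N by (intro mult_left_mono power_mono) auto
    moreover have "N * (\<kappa> * norm \<eta>)\<^sup>2 = \<delta> / 2 * (norm \<eta>)\<^sup>2"
      using \<kappa>(2) by (simp add: power_mult_distrib)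
    moreover have "u (w + \<eta> *s v) \<le> u w + (2 * N * (y0 \<bullet> e \<eta>) + N * (norm (e \<eta>))\<^sup>2)
        - (2 * \<delta> * (\<xi>0 \<bullet> \<eta>) + \<delta> * (norm \<eta>)\<^sup>2)"
      using * unfolding n1 n2 by (simp add: algebra_simps)
    moreover have "\<delta> / 2 * (norm \<eta>)\<^sup>2 + \<delta> / 2 * (norm \<eta>)\<^sup>2 = \<delta> * (norm \<eta>)\<^sup>2" by (simp add: field_simps)
    ultimately show ?thesis by linarith
  qed
  have disc: "w + \<mu> *s (of_real r *s v) = w + (of_real r * \<mu>) *s v" for \<mu>
    by (simp add: vec_eq_iff)
  have wD: "w \<in> D" using near[of 0] R by simp
  have disc_in: "w + \<mu> *s (of_real r *s v) \<in> D" if "norm \<mu> \<le> 1" for \<mu>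
  proof -
    have "r * norm \<mu> \<le> r" using r that by (simp add: mult_left_le)
    then have "r * norm \<mu> < R" using r by linarith
    then have "norm (of_real r * \<mu>) < R" using r by (simp add: norm_mult)
    then show ?thesis unfolding disc using near by blast
  qed
  note mean = continuous_plurisubharmonic_onD[OF psh wD disc_in, unfolded disc]
  have "((\<lambda>t. Re (E (of_real r * cis t))) has_integral Re (2 * pi * E 0)) {0..2 * pi}"
    using has_integral_linear[OF holomorphic_circle_mean[OF E r(1)] bounded_linear_Re]
    by (simp add: o_def)
  then have EI: "((\<lambda>t. Re (E (of_real r * cis t)) + (u w - \<delta> / 2 * r\<^sup>2)) has_integral
      0 + (2 * pi - 0) *\<^sub>R (u w - \<delta> / 2 * r\<^sup>2)) {0..2 * pi}"
    using E0 has_integral_const_real[of "u w - \<delta> / 2 * r\<^sup>2" 0 "2 * pi"]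
    by (intro has_integral_add) auto
  have "u (w + (of_real r * cis t) *s v) \<le> Re (E (of_real r * cis t)) + (u w - \<delta> / 2 * r\<^sup>2)" for t
    using le[of "of_real r * cis t"] r by (simp add: norm_mult)
  then have "integral {0..2 * pi} (\<lambda>t. u (w + (of_real r * cis t) *s v)) \<le>
      0 + (2 * pi - 0) *\<^sub>R (u w - \<delta> / 2 * r\<^sup>2)"
    by (intro has_integral_le[OF integrable_integral[OF mean(2)] EI])
  then have "integral {0..2 * pi} (\<lambda>t. u (w + (of_real r * cis t) *s v)) \<le>
      2 * pi * (u w - \<delta> / 2 * r\<^sup>2)"
    by (simp only: real_scaleR_def add_0 diff_zero)
  note order_trans[OF mean(1) this]
  moreover have "2 * pi * (u w - \<delta> / 2 * r\<^sup>2) < 2 * pi * u w"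
    using \<delta> r by (intro mult_strict_left_mono) auto
  ultimately show False by linarith
qed

subsection \<open>Analytic discs in balanced pseudoconvex domains\<close>

definition wscale :: "('n \<Rightarrow> nat) \<Rightarrow> complex \<Rightarrow> complex ^ 'n \<Rightarrow> complex ^ 'n" where
  "wscale k \<mu> z = (\<chi> i. \<mu> ^ k i * z $ i)"

lemma wscale_nth [simp]: "wscale k \<mu> z $ i = \<mu> ^ k i * z $ i"
  by (simp add: wscale_def)

lemma wscale_one [simp]: "wscale k 1 z = z"
  by (simp add: vec_eq_iff)

lemma wscale_wscale: "wscale k \<mu> (wscale k \<nu> z) = wscale k (\<mu> * \<nu>) z"
  by (simp add: vec_eq_iff power_mult_distrib mult.assoc)

lemma wscale_zero:
  assumes k: "\<And>i. k i \<ge> 1"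
  shows "wscale k 0 z = 0"
proof -
  have "(0::complex) ^ k i = 0" for i using k[of i] by (simp add: zero_power)
  then show ?thesis unfolding vec_eq_iff by simp
qed

lemma continuous_on_wscale [continuous_intros]:
  assumes "continuous_on S a" "continuous_on S b"
  shows "continuous_on S (\<lambda>x. wscale k (a x) (b x))"
  unfolding wscale_def by (intro continuous_intros assms)

lemma k_balancedD: "k_balanced k D \<Longrightarrow> norm \<mu> \<le> 1 \<Longrightarrow> z \<in> D \<Longrightarrow> wscale k \<mu> z \<in> D"
  by (simp add: k_balanced_def wscale_def)

lemma k_balanced_unscale:
  assumes "k_balanced k D" "norm \<mu> \<ge> 1" "wscale k \<mu> z \<in> D"
  shows "z \<in> D"
proof -
  have "norm (inverse \<mu>) \<le> 1"
    using assms(2) le_imp_inverse_le[of 1 "norm \<mu>"] by (simp add: norm_inverse)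
  then have "wscale k (inverse \<mu>) (wscale k \<mu> z) \<in> D"
    by (intro k_balancedD assms)
  moreover have "\<mu> \<noteq> 0" using assms(2) by auto
  ultimately show ?thesis by (simp add: wscale_wscale)
qed

lemma k_balanced_zero:
  assumes "k_balanced k D" "D \<noteq> {}" "\<And>i. k i \<ge> 1"
  shows "0 \<in> D"
proof -
  obtain z where "z \<in> D" using assms(2) by blast
  then show ?thesis using k_balancedD[OF assms(1), of 0 z] wscale_zero[of k z, OF assms(3)] by simp
qed

text \<open>Continuity method in the contraction parameter \<open>t\<close>: the set
  \<open>T\<close> of parameters whose whole disc lies in \<open>D\<close> contains 0 and is both
  closed and relatively open in the connected interval \<open>{0..1}\<close>.\<close>

lemma pseudoconvex_disc_filling:
  fixes \<psi> :: "complex \<Rightarrow> complex ^ 'n"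
  assumes pc: "pseudoconvex D" and bal: "k_balanced k D" and k: "\<And>i. k i \<ge> 1"
    and cont: "continuous_on (cball 0 1) \<psi>" and hol: "holomorphic_curve_on \<psi> (ball 0 1)"
    and bd: "\<And>\<xi>. norm \<xi> = 1 \<Longrightarrow> \<psi> \<xi> \<in> D"
    and "norm \<xi> \<le> 1"
  shows "\<psi> \<xi> \<in> D"
proof -
  obtain u where D: "open D" and psh: "continuous_plurisubharmonic_on u D" and ex: "\<And>c. compact {z \<in> D. u z \<le> c}"
    using pc by (auto simp: pseudoconvex_def)
  then have contu: "continuous_on D u" by (simp add: continuous_plurisubharmonic_on_def)
  define \<Gamma> where "\<Gamma> = (\<lambda>(t::real, \<xi>). wscale k (of_real t) (\<psi> \<xi>))"
  have cont\<Gamma>: "continuous_on (A \<times> cball 0 1) \<Gamma>" for A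
    unfolding \<Gamma>_def case_prod_unfold
    by (intro continuous_intros continuous_on_compose2[OF cont]) auto
  have bd\<Gamma>: "\<Gamma> (t, \<xi>) \<in> D" if "norm \<xi> = 1" "t \<in> {0..1}" for t \<xi>
    using that bd by (auto simp: \<Gamma>_def intro!: k_balancedD[OF bal])
  have "compact (u ` \<Gamma> ` ({0..1} \<times> sphere 0 1))"
  proof (intro compact_continuous_image)
    show "continuous_on ({0..1} \<times> sphere 0 1) \<Gamma>"
      by (rule continuous_on_subset[OF cont\<Gamma>[of "{0..1}"]]) auto
    show "continuous_on (\<Gamma> ` ({0..1} \<times> sphere 0 1)) u"
      by (rule continuous_on_subset[OF contu]) (use bd\<Gamma> in auto)
  qed (intro compact_Times compact_sphere compact_Icc)
  then have "bounded (u ` \<Gamma> ` ({0..1} \<times> sphere 0 1))" by (rule compact_imp_bounded)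
  then obtain c where c0: "\<And>x. x \<in> u ` \<Gamma> ` ({0..1} \<times> sphere 0 1) \<Longrightarrow> \<bar>x\<bar> \<le> c"
    unfolding bounded_iff real_norm_def by metis
  have c: "u (\<Gamma> (t, \<xi>)) \<le> c" if "t \<in> {0..1}" "norm \<xi> = 1" for t \<xi>
  proof -
    have "(t, \<xi>) \<in> {0..1} \<times> sphere 0 1" using that by simp
    then show ?thesis by (intro abs_le_D1[OF c0] imageI)
  qed
  define T where "T = {t \<in> {0..1}. \<forall>\<xi>\<in>cball 0 1. \<Gamma> (t, \<xi>) \<in> D}"
  \<comment> \<open>The bound \<open>c\<close> holds on all boundary circles, uniformly in
    \<open>t\<close>. The maximum principle extends it to each full disc inside \<open>D\<close>, so
    \<open>T\<close> is cut out by membership in one compact, hence closed, sublevel set.\<close>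
  have T_eq: "T = {t \<in> {0..1}. \<forall>\<xi>\<in>cball 0 1. \<Gamma> (t, \<xi>) \<in> {z \<in> D. u z \<le> c}}"
  proof -
    have "u (\<Gamma> (t, \<xi>)) \<le> c" if t: "t \<in> T" and \<xi>: "norm \<xi> \<le> 1" for t \<xi>
    proof (rule plurisubharmonic_maximum_principle[OF psh D _ _ _ _ \<xi>])
      show "continuous_on (cball 0 1) (\<lambda>\<xi>. \<Gamma> (t, \<xi>))"
        using cont by (auto simp: \<Gamma>_def intro!: continuous_intros)
      show "holomorphic_curve_on (\<lambda>\<xi>. \<Gamma> (t, \<xi>)) (ball 0 1)"
        using hol by (auto simp: \<Gamma>_def holomorphic_curve_on_def intro!: holomorphic_intros)
    next
      show "(\<lambda>\<xi>. \<Gamma> (t, \<xi>)) ` cball 0 1 \<subseteq> D" using t unfolding T_def by blast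
      show "u (\<Gamma> (t, \<xi>)) \<le> c" if "norm \<xi> = 1" for \<xi>
        using t that by (intro c) (simp_all add: T_def)
    qed
    then show ?thesis by (auto simp: T_def)
  qed
  have "closed T"
  proof -
    have "closed {t \<in> {0..1}. \<Gamma> (t, \<xi>) \<in> {z \<in> D. u z \<le> c}}" if "\<xi> \<in> cball 0 1" for \<xi>
    proof -
      have "continuous_on {0..1} (\<lambda>t. \<Gamma> (t, \<xi>))"
        by (rule continuous_on_compose2[OF cont\<Gamma>[of "{0..1}"]]) (use that in \<open>auto intro!: continuous_intros\<close>)
      then have "closed ({0..1} \<inter> (\<lambda>t. \<Gamma> (t, \<xi>)) -` {z \<in> D. u z \<le> c})"
        by (rule continuous_closed_preimage[OF _ closed_atLeastAtMost compact_imp_closed[OF ex]])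
      moreover have "{0..1} \<inter> (\<lambda>t. \<Gamma> (t, \<xi>)) -` {z \<in> D. u z \<le> c} =
          {t \<in> {0..1}. \<Gamma> (t, \<xi>) \<in> {z \<in> D. u z \<le> c}}" by blast
      ultimately show ?thesis by metis
    qed
    then have "closed (\<Inter>\<xi>\<in>cball 0 1. {t \<in> {0..1}. \<Gamma> (t, \<xi>) \<in> {z \<in> D. u z \<le> c}})" by (intro closed_INT ballI)
    moreover have "T = (\<Inter>\<xi>\<in>cball 0 1. {t \<in> {0..1}. \<Gamma> (t, \<xi>) \<in> {z \<in> D. u z \<le> c}})"
    proof (intro set_eqI iffI)
      fix t assume "t \<in> T"
      then show "t \<in> (\<Inter>\<xi>\<in>cball 0 1. {t \<in> {0..1}. \<Gamma> (t, \<xi>) \<in> {z \<in> D. u z \<le> c}})"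
        unfolding T_eq by blast
    next
      fix t assume *: "t \<in> (\<Inter>\<xi>\<in>cball 0 1. {t \<in> {0..1}. \<Gamma> (t, \<xi>) \<in> {z \<in> D. u z \<le> c}})"
      have "(0::complex) \<in> cball 0 1" by simp
      with * have "t \<in> {0..1}" by blast
      with * show "t \<in> T" unfolding T_eq by blast
    qed
    ultimately show ?thesis by simp
  qed
  \<comment> \<open>The complement of \<open>T\<close> is the projection of the compact set of pairs
    that \<open>\<Gamma>\<close> sends outside \<open>D\<close>.\<close>
  moreover have "closed ({0..1} - T)"
  proof -
    have comp: "compact ({0..1::real} \<times> cball (0::complex) 1)"
      by (intro compact_Times compact_cball) simp
    have "closed (({0..1} \<times> cball 0 1) \<inter> \<Gamma> -` (- D))"
      using D compact_imp_closed[OF comp] by (intro continuous_closed_preimage cont\<Gamma>) auto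
    from compact_Int_closed[OF comp this] have "compact (({0..1} \<times> cball 0 1) \<inter> \<Gamma> -` (- D))"
      by simp
    then have "compact (fst ` (({0..1} \<times> cball 0 1) \<inter> \<Gamma> -` (- D)))"
      by (rule compact_continuous_image[OF continuous_on_fst[OF continuous_on_id]])
    moreover have "{0..1} - T = fst ` (({0..1} \<times> cball 0 1) \<inter> \<Gamma> -` (- D))"
    proof (intro set_eqI iffI)
      fix t assume "t \<in> {0..1} - T"
      then obtain \<xi> where "t \<in> {0..1}" "\<xi> \<in> cball 0 1" "\<Gamma> (t, \<xi>) \<notin> D" by (auto simp: T_def)
      then show "t \<in> fst ` (({0..1} \<times> cball 0 1) \<inter> \<Gamma> -` (- D))"
        by (intro image_eqI[of _ _ "(t, \<xi>)"]) auto
    qed (auto simp: T_def)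
    ultimately show ?thesis using compact_imp_closed by metis
  qed
  moreover have "T \<inter> ({0..1} - T) \<inter> {0..1} = {}" "{0..1} \<subseteq> T \<union> ({0..1} - T)" by blast+
  ultimately have "T \<inter> {0..1} = {} \<or> ({0..1} - T) \<inter> {0..1} = {}"
    by (metis connected_closedD[OF connected_Icc])
  moreover have "0 \<in> T"
  proof -
    have "D \<noteq> {}" using bd[of 1] by auto
    then have 0: "0 \<in> D" by (intro k_balanced_zero[of k] bal k)
    have "wscale k 0 z \<in> D" for z
      unfolding wscale_zero[of k z, OF k] by (rule 0)
    then show ?thesis by (simp add: T_def \<Gamma>_def)
  qed
  moreover have "(0::real) \<in> {0..1}" "(1::real) \<in> {0..1}" by simp_all
  ultimately have "1 \<in> T" by (metis Diff_iff disjoint_iff)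
  then show ?thesis using \<open>norm \<xi> \<le> 1\<close> by (simp add: T_def \<Gamma>_def)
qed

section \<open>Quotients of curves by powers of a Moebius function\<close>

text \<open>Together the two facts bound \<open>1 - |m|^2\<close> by a constant times
  \<open>1 - |z|^2\<close>, so the modulus of the Moebius function tends to 1 uniformly at the
  circle.\<close>

lemma norm_Moebius_function:
  assumes "norm a < 1" "norm z \<le> 1"
  shows "1 - (norm (Moebius_function 0 a z))\<^sup>2 =
    (1 - (norm a)\<^sup>2) * (1 - (norm z)\<^sup>2) / (norm (1 - cnj a * z))\<^sup>2"
    and "norm (1 - cnj a * z) \<ge> 1 - norm a"
proof -
  have "norm (cnj a * z) \<le> norm a"
    using assms by (simp add: norm_mult mult_left_le)
  then show ge: "norm (1 - cnj a * z) \<ge> 1 - norm a"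
    using norm_triangle_ineq2[of 1 "cnj a * z"] by simp
  then have nz: "(norm (1 - cnj a * z))\<^sup>2 \<noteq> 0" using assms by auto
  have "(norm (1 - cnj a * z))\<^sup>2 - (norm (z - a))\<^sup>2 = (1 - (norm a)\<^sup>2) * (1 - (norm z)\<^sup>2)"
    unfolding cmod_power2 by (simp add: algebra_simps power2_eq_square)
  then show "1 - (norm (Moebius_function 0 a z))\<^sup>2 =
    (1 - (norm a)\<^sup>2) * (1 - (norm z)\<^sup>2) / (norm (1 - cnj a * z))\<^sup>2"
    using nz by (simp add: Moebius_function_simple norm_divide power_divide field_simps)
qed

lemma holomorphic_curve_continuous_on:
  assumes "holomorphic_curve_on \<phi> U"
  shows "continuous_on U \<phi>"
proof -
  have "continuous_on U (\<lambda>z. \<chi> i. \<phi> z $ i)"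
    using assms by (intro continuous_on_vec_lambda holomorphic_on_imp_continuous_on)
      (auto simp: holomorphic_curve_on_def)
  then show ?thesis by simp
qed

lemma holomorphic_curve_on_compose:
  assumes "holomorphic_curve_on \<phi> U" "g holomorphic_on S" "g ` S \<subseteq> U"
  shows "holomorphic_curve_on (\<lambda>z. \<phi> (g z)) S"
  unfolding holomorphic_curve_on_def
proof
  fix i
  have "(\<lambda>z. \<phi> z $ i) \<circ> g holomorphic_on S"
    using assms by (intro holomorphic_on_compose_gen) (auto simp: holomorphic_curve_on_def)
  then show "(\<lambda>z. \<phi> (g z) $ i) holomorphic_on S" by (simp add: o_def)
qed

lemma holomorphic_curve_on_wscale:
  assumes "holomorphic_curve_on \<phi> S" "g holomorphic_on S"
  shows "holomorphic_curve_on (\<lambda>z. wscale k (g z) (\<phi> z)) S"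
  using assms by (auto simp: holomorphic_curve_on_def intro!: holomorphic_intros)

text \<open>On a circle close to the boundary the Moebius factor \<open>m\<close> has modulus at
  least \<open>s\<close>. There scaling \<open>\<phi>\<close> by \<open>s\<close> amounts to scaling
  the point of the curve in \<open>D\<close> by \<open>s / m\<close>, of modulus at most 1. Disc
  filling carries membership in \<open>D\<close> to the interior.\<close>

lemma Moebius_quotient_shrunk_in_domain:
  fixes \<phi> :: "complex \<Rightarrow> complex ^ 'n"
  assumes pc: "pseudoconvex D" and bal: "k_balanced k D" and k: "\<And>i. k i \<ge> 1"
    and \<alpha>: "norm \<alpha> < 1" and hol: "holomorphic_curve_on \<phi> (ball 0 1)"
    and f: "\<And>z. norm z < 1 \<Longrightarrow> wscale k (Moebius_function 0 \<alpha> z) (\<phi> z) \<in> D"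
    and s: "0 < s" "s < 1" and \<zeta>: "norm \<zeta> < 1"
  shows "wscale k (of_real s) (\<phi> \<zeta>) \<in> D"
proof -
  \<comment> \<open>With this \<open>C\<close>, \<open>1 - |m|^2 \<le> C * (1 - \<rho>^2)\<close> on
    the circle of radius \<open>\<rho>\<close>; letting \<open>\<rho>\<close> tend to 1 makes the
    bound smaller than \<open>1 - s^2\<close>.\<close>
  define C where "C = (1 - (norm \<alpha>)\<^sup>2) / (1 - norm \<alpha>)\<^sup>2"
  have "((\<lambda>\<rho>::real. C * (1 - \<rho>\<^sup>2)) \<longlongrightarrow> C * (1 - 1\<^sup>2)) (at_left 1)"
    by (intro tendsto_intros)
  moreover have "s\<^sup>2 < 1" using s by (simp add: power_less_one_iff abs_square_less_1)
  ultimately have "\<forall>\<^sub>F \<rho> in at_left 1. C * (1 - \<rho>\<^sup>2) < 1 - s\<^sup>2"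
    by (intro order_tendstoD) auto
  moreover have "\<forall>\<^sub>F \<rho> in at_left 1. \<rho> \<in> {norm \<zeta><..<1}"
    using \<zeta> by (rule eventually_at_leftI[of "norm \<zeta>", rotated]) auto
  ultimately have "\<forall>\<^sub>F \<rho> in at_left 1. C * (1 - \<rho>\<^sup>2) < 1 - s\<^sup>2 \<and> \<rho> \<in> {norm \<zeta><..<1}"
    by eventually_elim auto
  then obtain \<rho> where \<rho>: "C * (1 - \<rho>\<^sup>2) < 1 - s\<^sup>2" "norm \<zeta> < \<rho>" "\<rho> < 1"
    using eventually_happens'[OF trivial_limit_at_left_real] by auto
  have \<rho>0: "\<rho> > 0" using \<rho>(2) norm_ge_zero[of \<zeta>] by linarith
  have large: "norm (Moebius_function 0 \<alpha> z) \<ge> s" if z: "norm z = \<rho>" for z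
  proof -
    have z1: "norm z \<le> 1" using z \<rho> by simp
    have "1 - (norm (Moebius_function 0 \<alpha> z))\<^sup>2 = (1 - (norm \<alpha>)\<^sup>2) * (1 - \<rho>\<^sup>2) / (norm (1 - cnj \<alpha> * z))\<^sup>2"
      using norm_Moebius_function(1)[OF \<alpha> z1] z by simp
    also have "\<dots> \<le> (1 - (norm \<alpha>)\<^sup>2) * (1 - \<rho>\<^sup>2) / (1 - norm \<alpha>)\<^sup>2"
      using \<alpha> \<rho> \<rho>0 norm_Moebius_function(2)[OF \<alpha> z1]
      by (intro divide_left_mono mult_nonneg_nonneg power_mono mult_pos_pos zero_less_power)
         (auto simp: power_le_one)
    also have "\<dots> \<le> 1 - s\<^sup>2" using \<rho>(1) by (simp add: C_def)
    finally have "s\<^sup>2 \<le> (norm (Moebius_function 0 \<alpha> z))\<^sup>2" by linarith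
    then show ?thesis by (rule power2_le_imp_le) simp
  qed
  define \<psi> where "\<psi> w = wscale k (of_real s) (\<phi> (of_real \<rho> * w))" for w
  have "norm (of_real \<rho> * w) < 1" if "norm w \<le> 1" for w :: complex
  proof -
    have "\<rho> * norm w \<le> \<rho>" using that \<rho>0 by (simp add: mult_left_le)
    then have "\<rho> * norm w < 1" using \<rho> by linarith
    then show ?thesis using \<rho>0 by (simp add: norm_mult)
  qed
  then have sub: "(\<lambda>w::complex. of_real \<rho> * w) ` cball 0 1 \<subseteq> ball 0 1" by auto
  have hol\<psi>: "holomorphic_curve_on \<psi> (cball 0 1)"
    unfolding \<psi>_def
    by (intro holomorphic_curve_on_wscale holomorphic_curve_on_compose[OF hol _ sub] holomorphic_intros)
  have "\<psi> (\<zeta> / of_real \<rho>) \<in> D"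
  proof (rule pseudoconvex_disc_filling[of D k, OF pc bal k])
    show "continuous_on (cball 0 1) \<psi>" by (rule holomorphic_curve_continuous_on[OF hol\<psi>])
    show "holomorphic_curve_on \<psi> (ball 0 1)"
      using hol\<psi> ball_subset_cball by (auto simp: holomorphic_curve_on_def intro: holomorphic_on_subset)
    show "norm (\<zeta> / of_real \<rho>) \<le> 1" using \<rho> \<rho>0 by (simp add: norm_divide)
  next
    fix w :: complex assume w: "norm w = 1"
    define m where "m = Moebius_function 0 \<alpha> (of_real \<rho> * w)"
    have m: "norm m \<ge> s" unfolding m_def using w \<rho>0 by (intro large) (simp add: norm_mult)
    then have m0: "m \<noteq> 0" using s by auto
    have "wscale k m (\<phi> (of_real \<rho> * w)) \<in> D"
      unfolding m_def using w \<rho> \<rho>0 by (intro f) (simp add: norm_mult)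
    moreover have "norm (of_real s / m) \<le> 1" using m m0 s by (simp add: norm_divide)
    ultimately have "wscale k (of_real s / m) (wscale k m (\<phi> (of_real \<rho> * w))) \<in> D"
      using k_balancedD[OF bal] by metis
    then show "\<psi> w \<in> D" using m0 by (simp add: wscale_wscale \<psi>_def)
  qed
  then show ?thesis using \<rho>0 by (simp add: \<psi>_def)
qed

text \<open>Take a point \<open>b\<close> outside \<open>E\<close> closest to some \<open>a\<close>
  in \<open>E\<close>; the open disc about \<open>a\<close> through \<open>b\<close> lies in
  \<open>E\<close>. On a small circle about \<open>b\<close>, the arc facing \<open>a\<close> is
  sent into \<open>D\<close>, while on the other arc only shrunken values are known to lie in
  \<open>D\<close>. A scaling factor that shrinks on the second arc but expands at the centre forces
  \<open>\<phi> b\<close> into \<open>D\<close>.\<close>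

lemma Moebius_quotient_all_in_domain:
  fixes \<phi> :: "complex \<Rightarrow> complex ^ 'n"
  assumes pc: "pseudoconvex D" and bal: "k_balanced k D" and k: "\<And>i. k i \<ge> 1"
    and \<alpha>: "norm \<alpha> < 1" and hol: "holomorphic_curve_on \<phi> (ball 0 1)"
    and f: "\<And>z. norm z < 1 \<Longrightarrow> wscale k (Moebius_function 0 \<alpha> z) (\<phi> z) \<in> D"
    and \<zeta>: "norm \<zeta> < 1" "\<phi> \<zeta> \<in> D"
  shows "\<phi> ` ball 0 1 \<subseteq> D"
proof (rule ccontr)
  assume neg: "\<not> \<phi> ` ball 0 1 \<subseteq> D"
  have D: "open D" using pc by (simp add: pseudoconvex_def)
  define E where "E = ball 0 1 \<inter> \<phi> -` D"
  have E: "open E"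
    unfolding E_def by (intro continuous_open_preimage holomorphic_curve_continuous_on[OF hol] D open_ball)
  have "ball 0 1 \<inter> E \<noteq> {}" "ball 0 1 - E \<noteq> {}"
    using \<zeta> neg by (auto simp: E_def)
  then have "ball 0 1 \<inter> frontier E \<noteq> {}"
    by (rule connected_Int_frontier[OF connected_ball])
  then obtain b0 where b0: "norm b0 < 1" "b0 \<in> closure E" "b0 \<notin> E"
    using E by (auto simp: frontier_def interior_open)
  \<comment> \<open>A quarter of the gap \<open>1 - norm b0\<close> leaves room for \<open>b\<close>
    and the small disc about it inside the unit disc.\<close>
  then obtain a where a: "a \<in> E" "dist a b0 < (1 - norm b0) / 4"
  proof -
    have "(1 - norm b0) / 4 > 0" using b0(1) by simp
    then show ?thesis using b0(2) that unfolding closure_approachable by blast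
  qed
  have "closed (- E)" "- E \<noteq> {}" using E b0 by auto
  then obtain b where b: "b \<notin> E" and near: "\<And>y. y \<notin> E \<Longrightarrow> dist a b \<le> dist a y"
    using distance_attains_inf[of "- E" a] by (metis Compl_iff)
  define r where "r = norm (a - b)"
  have r: "r > 0" "r < (1 - norm b0) / 4"
    using a b near[OF b0(3)] by (auto simp: r_def dist_norm)
  have inE: "z \<in> E" if "norm (a - z) < r" for z
    using near[of z] that by (force simp: r_def dist_norm)
  \<comment> \<open>Parametrises a disc of radius \<open>r / 10\<close> about \<open>b\<close>, with
    \<open>w = 1\<close> in the direction of \<open>a\<close>.\<close>
  define c where "c w = b + (a - b) * w / 10" for w
  have c_in: "norm (c w) < 1" if "norm w \<le> 1" for w
  proof -
    have "norm ((a - b) * w / 10) \<le> r / 10"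
      using mult_left_mono[OF that, of r] r by (simp add: norm_mult norm_divide r_def)
    moreover have "norm (c w) \<le> norm b + norm ((a - b) * w / 10)"
      unfolding c_def by (rule norm_triangle_ineq)
    moreover have "norm b \<le> norm b0 + norm (a - b0) + r"
      unfolding r_def by norm
    ultimately show ?thesis using r a(2) by (simp add: dist_norm)
  qed
  have c0: "norm b < 1" using c_in[of 0] by (simp add: c_def)
  \<comment> \<open>\<open>Re p\<close> is negative on slightly more than the half circle that may leave \<open>E\<close>, but \<open>p 0 > 0\<close>.
    For small \<open>\<tau>\<close> the factor \<open>exp (\<tau> p)\<close> therefore keeps the boundary in \<open>D\<close> and expands at \<open>b\<close>.\<close>
  define p :: "complex \<Rightarrow> complex" where "p w = 1 / 4 + w + w\<^sup>2 / 2" for w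
  have Re_p: "Re (p w) = (Re w)\<^sup>2 + Re w - 1 / 4" if "norm w = 1" for w
  proof -
    have "(Re w)\<^sup>2 + (Im w)\<^sup>2 = 1" using that cmod_power2[of w] by simp
    then have "Re (w\<^sup>2) = 2 * (Re w)\<^sup>2 - 1" by (simp add: power2_eq_square)
    then show ?thesis by (simp add: p_def field_simps)
  qed
  have Re_p_neg: "Re (p w) < 0" if w: "norm w = 1" "Re w < 1 / 10" for w
  proof -
    have "Re w \<ge> -1" using w(1) abs_Re_le_cmod[of w] by linarith
    then have "(Re w + 1) * (Re w - 1 / 10) \<le> 0"
      using w(2) by (intro mult_nonneg_nonpos) auto
    then show ?thesis unfolding Re_p[OF w(1)] power2_eq_square
      using w(2) \<open>Re w \<ge> -1\<close> by (simp add: algebra_simps)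
  qed
  \<comment> \<open>For \<open>norm w = 1\<close>,
    \<open>|1 - w/10|^2 = 1 - Re w / 5 + 1 / 100\<close>, which is below 1 as soon as
    \<open>Re w > 1/20\<close>. The threshold \<open>1/10\<close> therefore keeps \<open>c w\<close>
    inside the disc about \<open>a\<close>.\<close>
  define P where "P = {w. norm w = 1 \<and> Re w \<ge> 1 / 10}"
  have P_in: "\<phi> (c w) \<in> D" if "w \<in> P" for w
  proof -
    have w: "(Re w)\<^sup>2 + (Im w)\<^sup>2 = 1" "Re w \<ge> 1 / 10"
      using that cmod_power2[of w] by (auto simp: P_def)
    have "(norm (1 - w / 10))\<^sup>2 < 1"
      using w unfolding cmod_power2 by (simp add: power2_eq_square field_simps)
    then have "norm (1 - w / 10) < 1" by (simp add: abs_square_less_1)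
    moreover have "a - c w = (a - b) * (1 - w / 10)" by (simp add: c_def algebra_simps)
    ultimately have "norm (a - c w) < r" using r(1) by (simp add: norm_mult r_def)
    then show ?thesis using inE by (auto simp: E_def)
  qed
  have contc: "continuous_on UNIV c" unfolding c_def by (intro continuous_intros) auto
  define V where "V = c -` ball 0 1"
  have V: "open V" unfolding V_def using contc by (intro open_vimage open_ball)
  \<comment> \<open>At \<open>\<tau> = 0\<close> the arc \<open>P\<close> is sent into
    \<open>D\<close>; since \<open>P\<close> is compact, the tube lemma preserves this for some
    positive \<open>\<tau>\<close>.\<close>
  define \<Gamma> where "\<Gamma> = (\<lambda>(\<tau>::real, w). wscale k (exp (of_real \<tau> * p w)) (\<phi> (c w)))"
  have "continuous_on (UNIV \<times> V) \<Gamma>"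
    unfolding \<Gamma>_def case_prod_unfold p_def
    by (intro continuous_intros continuous_on_compose2[OF holomorphic_curve_continuous_on[OF hol]]
        continuous_on_compose2[OF contc]) (auto simp: V_def)
  then have W: "open ((UNIV \<times> V) \<inter> \<Gamma> -` D)"
    by (rule continuous_open_preimage) (intro open_Times open_UNIV V D)+
  have "compact P"
  proof -
    have "P = sphere 0 1 \<inter> {w. Re w \<ge> 1 / 10}" by (auto simp: P_def)
    then show ?thesis using closed_halfspace_Re_ge by (metis compact_Int_closed compact_sphere)
  qed
  moreover have "{0} \<times> P \<subseteq> (UNIV \<times> V) \<inter> \<Gamma> -` D"
    using P_in c_in by (auto simp: \<Gamma>_def V_def) (auto simp: P_def)
  ultimately obtain X where X: "0 \<in> X" "open X" "X \<times> P \<subseteq> (UNIV \<times> V) \<inter> \<Gamma> -` D"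
    using Elementary_Topology.tube_lemma[OF _ W] by metis
  then obtain e where e: "e > 0" "ball 0 e \<subseteq> X" using open_contains_ball by metis
  define \<tau> where "\<tau> = e / 2"
  have \<tau>: "\<tau> > 0" "\<tau> \<in> X" using e by (auto simp: \<tau>_def intro!: subsetD[OF e(2)])
  define \<psi> where "\<psi> w = wscale k (exp (of_real \<tau> * p w)) (\<phi> (c w))" for w
  have hol\<psi>: "holomorphic_curve_on \<psi> (cball 0 1)"
    unfolding \<psi>_def p_def
  proof (intro holomorphic_curve_on_wscale holomorphic_curve_on_compose[OF hol])
    show "c ` cball 0 1 \<subseteq> ball 0 1" using c_in by auto
    show "c holomorphic_on cball 0 1" unfolding c_def by (intro holomorphic_intros) auto
  qed (intro holomorphic_intros, auto)
  have "\<psi> 0 \<in> D"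
  proof (rule pseudoconvex_disc_filling[of D k, OF pc bal k])
    show "continuous_on (cball 0 1) \<psi>" by (rule holomorphic_curve_continuous_on[OF hol\<psi>])
    show "holomorphic_curve_on \<psi> (ball 0 1)"
      using hol\<psi> ball_subset_cball by (auto simp: holomorphic_curve_on_def intro: holomorphic_on_subset)
  next
    fix w :: complex assume w: "norm w = 1"
    show "\<psi> w \<in> D"
    proof (cases "w \<in> P")
      case True
      then have "(\<tau>, w) \<in> X \<times> P" using \<tau> by simp
      then show ?thesis using X(3) by (auto simp: \<Gamma>_def \<psi>_def)
    next
      case False
      define m where "m = exp (of_real \<tau> * p w)"
      have m: "norm m = exp (\<tau> * Re (p w))" by (simp add: m_def)
      have "Re w < 1 / 10" using False w by (simp add: P_def)
      then have "\<tau> * Re (p w) < 0" using Re_p_neg[OF w] \<tau> by (simp add: mult_pos_neg)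
      then have m1: "0 < norm m" "norm m < 1" by (auto simp: m)
      \<comment> \<open>The shrinking lemma handles the real factor \<open>norm m\<close>; the
        remaining unimodular factor is absorbed by balancedness.\<close>
      have "wscale k (of_real (norm m)) (\<phi> (c w)) \<in> D"
        by (rule Moebius_quotient_shrunk_in_domain[of D k, OF pc bal k \<alpha> hol f m1 c_in]) (use w in auto)
      moreover have "norm (m / of_real (norm m)) \<le> 1" using m1 by (simp add: norm_divide)
      ultimately have "wscale k (m / of_real (norm m)) (wscale k (of_real (norm m)) (\<phi> (c w))) \<in> D"
        using k_balancedD[OF bal] by metis
      then show ?thesis using m1 by (simp add: wscale_wscale \<psi>_def m_def)
    qed
  qed simp
  then have "wscale k (exp (of_real \<tau> * (1 / 4))) (\<phi> b) \<in> D" by (simp add: \<psi>_def p_def c_def)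
  moreover have "norm (exp (of_real \<tau> * (1 / 4) :: complex)) \<ge> 1" using \<tau> by simp
  ultimately have "\<phi> b \<in> D" using k_balanced_unscale[OF bal] by metis
  with b c0 show False by (simp add: E_def)
qed

text \<open>If \<open>\<phi>\<close> meets \<open>D\<close>, the barrier argument keeps all of it in
  \<open>D\<close>. Otherwise each \<open>\<phi> \<zeta>\<close> is the limit, as \<open>s\<close>
  increases to 1, of the points scaled by \<open>s\<close> in \<open>D\<close>, so it lies in the
  closure but not in \<open>D\<close>.\<close>

theorem Moebius_quotient_dichotomy:
  fixes \<phi> :: "complex \<Rightarrow> complex ^ 'n"
  assumes pc: "pseudoconvex D" and bal: "k_balanced k D" and k: "\<And>i. k i \<ge> 1"
    and \<alpha>: "norm \<alpha> < 1" and hol: "holomorphic_curve_on \<phi> (ball 0 1)"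
    and f: "\<And>z. norm z < 1 \<Longrightarrow> wscale k (Moebius_function 0 \<alpha> z) (\<phi> z) \<in> D"
  shows "\<phi> ` ball 0 1 \<subseteq> D \<or> \<phi> ` ball 0 1 \<subseteq> frontier D"
proof (cases "\<phi> ` ball 0 1 \<inter> D = {}")
  case True
  have "\<phi> \<zeta> \<in> closure D" if \<zeta>: "norm \<zeta> < 1" for \<zeta>
  proof -
    have "((\<lambda>s. wscale k (of_real s) (\<phi> \<zeta>)) \<longlongrightarrow> wscale k (of_real 1) (\<phi> \<zeta>)) (at_left 1)"
      unfolding wscale_def by (intro tendsto_intros)
    moreover have "\<forall>\<^sub>F s in at_left 1. wscale k (of_real s) (\<phi> \<zeta>) \<in> closure D"
    proof (rule eventually_at_leftI[of 0])
      fix s :: real assume "s \<in> {0<..<1}"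
      then have "wscale k (of_real s) (\<phi> \<zeta>) \<in> D"
        by (intro Moebius_quotient_shrunk_in_domain[of D k, OF pc bal k \<alpha> hol f _ _ \<zeta>]) auto
      then show "wscale k (of_real s) (\<phi> \<zeta>) \<in> closure D" using closure_subset by blast
    qed simp
    ultimately show ?thesis
      using Lim_in_closed_set[OF closed_closure _ trivial_limit_at_left_real] by fastforce
  qed
  moreover have "open D" using pc by (simp add: pseudoconvex_def)
  ultimately have "\<phi> ` ball 0 1 \<subseteq> frontier D"
    using True by (fastforce simp: frontier_def interior_open)
  then show ?thesis ..
next
  case False
  then obtain \<zeta> where "norm \<zeta> < 1" "\<phi> \<zeta> \<in> D" by auto
  then show ?thesis using Moebius_quotient_all_in_domain[of D k, OF pc bal k \<alpha> hol f] by blast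
qed

subsection \<open>Holomorphic dependence of fixed points\<close>

text \<open>Conjugating \<open>h\<close> by the Moebius map at \<open>a\<close> gives a map that
  fixes 0 and takes values of modulus below some \<open>c < 1\<close>. Schwarz's lemma for this map
  divided by \<open>c\<close> yields a contraction of the pseudohyperbolic distance to
  \<open>a\<close>, stated with denominators cleared. The derivative bound is its limit at
  \<open>a\<close>.\<close>

lemma Schwarz_Pick_fixed_point:
  assumes hol: "h holomorphic_on ball 0 1" and bd: "\<And>z. norm z < 1 \<Longrightarrow> norm (h z) \<le> r" and r: "r < 1"
    and a: "norm a < 1" "h a = a"
  obtains c where "0 < c" "c < 1"
    and "\<And>z. norm z < 1 \<Longrightarrow> norm (h z - a) * norm (1 - cnj a * z) \<le> c * norm (z - a) * norm (1 - cnj a * h z)"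
    and "norm (deriv h a) \<le> c"
proof -
  have r0: "r \<ge> 0" using bd[OF a(1)] norm_ge_zero order_trans by metis
  have ar: "norm a \<le> r" using bd[OF a(1)] a(2) by simp
  \<comment> \<open>As \<open>|1 - cnj a * w| \<le> 2\<close>, this is a lower bound for
    \<open>1 - |m|^2\<close>, with \<open>m\<close> the Moebius function at \<open>a\<close>
    evaluated at \<open>w\<close>. Taking \<open>c^2 = 1 - \<delta> / 2\<close> below makes the
    bound by \<open>c\<close> strict.\<close>
  define \<delta> where "\<delta> = (1 - r\<^sup>2)\<^sup>2 / 4"
  have "r\<^sup>2 < 1" using r r0 by (simp add: abs_square_less_1)
  then have \<delta>: "0 < \<delta>" "\<delta> < 1"
    using power_le_one[of "1 - r\<^sup>2" 2] by (auto simp: \<delta>_def)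
  define c where "c = sqrt (1 - \<delta> / 2)"
  have c: "0 < c" "c < 1" using \<delta> by (auto simp: c_def)
  have m_bd: "norm (Moebius_function 0 a w) < c" if w: "norm w \<le> r" for w
  proof -
    have w1: "norm w \<le> 1" using w r by simp
    have "norm (1 - cnj a * w) \<le> 2"
      using norm_triangle_ineq4[of 1 "cnj a * w"] mult_mono[of "norm a" 1 "norm w" 1] a w1
      by (simp add: norm_mult)
    then have le4: "(norm (1 - cnj a * w))\<^sup>2 \<le> 4"
      using power_mono[of "norm (1 - cnj a * w)" 2 2] by simp
    have pos: "0 < (norm (1 - cnj a * w))\<^sup>2"
      using norm_Moebius_function(2)[OF a(1) w1] a by auto
    have "(1 - r\<^sup>2) * (1 - r\<^sup>2) \<le> (1 - (norm a)\<^sup>2) * (1 - (norm w)\<^sup>2)"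
      using \<open>r\<^sup>2 < 1\<close> ar w power_mono[of "norm a" r 2] power_mono[of "norm w" r 2]
      by (intro mult_mono) auto
    then have "\<delta> \<le> (1 - (norm a)\<^sup>2) * (1 - (norm w)\<^sup>2) / 4"
      by (simp add: \<delta>_def power2_eq_square)
    also have "\<dots> \<le> (1 - (norm a)\<^sup>2) * (1 - (norm w)\<^sup>2) / (norm (1 - cnj a * w))\<^sup>2"
      using pos le4 a w1 by (intro divide_left_mono mult_nonneg_nonneg mult_pos_pos) (auto simp: power_le_one)
    finally have "(norm (Moebius_function 0 a w))\<^sup>2 \<le> 1 - \<delta>"
      unfolding norm_Moebius_function(1)[OF a(1) w1, symmetric] by simp
    also have "\<dots> < c\<^sup>2" using \<delta> by (simp add: c_def)
    finally show ?thesis by (rule power2_less_imp_less) (use c in simp)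
  qed
  define k where "k z = Moebius_function 0 a (h (Moebius_function 0 (- a) z)) / of_real c" for z
  have lt: "norm (Moebius_function 0 b z) < 1" if "norm b = norm a" "norm z < 1" for b z
    using that a by (intro Moebius_function_norm_lt_1) auto
  have ball: "norm (h z) < 1" if "norm z < 1" for z using bd[OF that] r by simp
  have holk: "k holomorphic_on ball 0 1"
  proof -
    have "Moebius_function 0 (- a) holomorphic_on ball 0 1"
      using a by (intro Moebius_function_holomorphic) simp
    then have "h \<circ> Moebius_function 0 (- a) holomorphic_on ball 0 1"
      by (rule holomorphic_on_compose_gen[OF _ hol]) (use lt[of "- a"] in auto)
    then have "Moebius_function 0 a \<circ> (h \<circ> Moebius_function 0 (- a)) holomorphic_on ball 0 1"
      by (rule holomorphic_on_compose_gen[OF _ Moebius_function_holomorphic[OF a(1)]])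
         (use lt[of "- a"] ball in auto)
    then show ?thesis unfolding k_def o_def using c by (intro holomorphic_intros) auto
  qed
  have k0: "k 0 = 0" by (simp add: k_def Moebius_function_of_zero a Moebius_function_eq_zero)
  have k1: "norm (k z) < 1" if "norm z < 1" for z
    using c m_bd[OF bd[OF lt[of "- a" z]]] that by (simp add: k_def norm_divide)
  have *: "norm (Moebius_function 0 a (h z)) \<le> c * norm (Moebius_function 0 a z)" if z: "norm z < 1" for z
    using Schwarz_Lemma(1)[OF holk k0 k1 lt[of a z]] z a c
    by (simp add: k_def norm_divide Moebius_function_compose field_simps)
  have nz: "norm (1 - cnj a * z) > 0" if "norm z < 1" for z
    using norm_Moebius_function(2)[OF a(1), of z] that a(1) by linarith
  have main: "norm (h z - a) * norm (1 - cnj a * z) \<le> c * norm (z - a) * norm (1 - cnj a * h z)"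
    if z: "norm z < 1" for z
    using *[OF z] nz[OF z] nz[OF ball[OF z]]
    by (simp add: Moebius_function_simple norm_divide field_simps)
  have "norm (deriv h a) \<le> c * (norm (1 - cnj a * h a) / norm (1 - cnj a * a))"
  proof (rule tendsto_le[OF trivial_limit_at])
    have "(h has_field_derivative deriv h a) (at a)"
      using hol a(1) by (intro holomorphic_derivI[of _ "ball 0 1"]) auto
    then show "((\<lambda>z. norm ((h z - h a) / (z - a))) \<longlongrightarrow> norm (deriv h a)) (at a)"
      unfolding has_field_derivative_iff by (rule tendsto_norm)
    have "isCont h a"
      using hol a(1) by (intro continuous_on_interior[of "ball 0 1"] holomorphic_on_imp_continuous_on) auto
    then have "(h \<longlongrightarrow> h a) (at a)" by (simp add: isCont_def)
    then show "((\<lambda>z. c * (norm (1 - cnj a * h z) / norm (1 - cnj a * z))) \<longlongrightarrow>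
        c * (norm (1 - cnj a * h a) / norm (1 - cnj a * a))) (at a)"
      using nz[OF a(1)] by (intro tendsto_intros) auto
    have "\<forall>\<^sub>F z in at a. z \<in> ball 0 1 \<and> z \<noteq> a"
      using a(1) eventually_at_in_open[of "ball 0 1" a] by (auto elim: eventually_mono)
    then show "\<forall>\<^sub>F z in at a. norm ((h z - h a) / (z - a)) \<le> c * (norm (1 - cnj a * h z) / norm (1 - cnj a * z))"
    proof eventually_elim
      case (elim z)
      then show ?case using main[of z] nz[of z] a(2) by (simp add: norm_divide field_simps)
    qed
  qed
  then have "norm (deriv h a) \<le> c" using nz[OF a(1)] a(2) by simp
  with c main show ?thesis by (intro that) 
qed

text \<open>Cauchy's estimate on discs of radius \<open>(1 - norm a) / 3\<close>. The constant is
  proportional to \<open>B\<close>, so a uniformly small function has small difference quotients at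
  \<open>a\<close>.\<close>

lemma bounded_holomorphic_Lipschitz:
  assumes hol: "f holomorphic_on ball 0 1" and bd: "\<And>z. norm z < 1 \<Longrightarrow> norm (f z) \<le> B"
    and a: "norm a < 1" and x: "norm (x - a) < (1 - norm a) / 3"
  shows "norm (f x - f a) \<le> 3 * B / (1 - norm a) * norm (x - a)"
proof -
  define d where "d = (1 - norm a) / 3"
  have d: "d > 0" using a by (simp add: d_def)
  have in1: "norm z < 1" if "norm (y - a) < d" "norm (z - y) \<le> d" for y z
  proof -
    have "norm z \<le> norm (z - y) + norm (y - a) + norm a" by norm
    then show ?thesis using that d by (simp add: d_def)
  qed
  show ?thesis
  proof (rule field_differentiable_bound[of "ball a d"])
    fix y assume y: "y \<in> ball a d"
    then have ya: "norm (y - a) < d" by (simp add: dist_norm norm_minus_commute)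
    have sub: "cball y d \<subseteq> ball 0 1" using in1[OF ya] by (auto simp: dist_norm norm_minus_commute)
    show "(f has_field_derivative deriv f y) (at y within ball a d)"
      using in1[OF ya, of y] d by (intro holomorphic_derivI[OF hol open_ball]) simp
    have "norm ((deriv ^^ 1) f y) \<le> fact 1 * B / d ^ 1"
    proof (rule Cauchy_inequality)
      show "f holomorphic_on ball y d" using hol sub ball_subset_cball by (blast intro: holomorphic_on_subset)
      show "continuous_on (cball y d) f"
        using hol sub by (blast intro: holomorphic_on_imp_continuous_on holomorphic_on_subset)
      show "norm (f z) \<le> B" if "norm (y - z) = d" for z
        using that by (intro bd in1[OF ya]) (simp add: norm_minus_commute)
    qed (rule d)
    then show "norm (deriv f y) \<le> 3 * B / (1 - norm a)" using a by (simp add: d_def field_simps)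
  qed (use x d in \<open>auto simp: d_def dist_norm norm_minus_commute\<close>)
qed

text \<open>Because \<open>f z = 0\<close>, the variation of \<open>p\<close> is multiplied by
  something of order \<open>norm (y - z)\<close>; a limit of \<open>p\<close> suffices in place of a
  derivative.\<close>

lemma has_derivative_mult_vanishing:
  fixes f p :: "'a::real_normed_vector \<Rightarrow> complex"
  assumes f: "(f has_derivative f') (at z)" and "f z = 0" and p: "(p \<longlongrightarrow> p0) (at z)"
  shows "((\<lambda>y. f y * p y) has_derivative (\<lambda>v. f' v * p0)) (at z)"
  unfolding has_derivative_iff_norm
proof
  have bl: "bounded_linear f'" using f by (rule has_derivative_bounded_linear)
  then show "bounded_linear (\<lambda>v. f' v * p0)" by (rule bounded_linear_mult_const)
  obtain K where K: "\<And>v. norm (f' v) \<le> norm v * K" using bounded_linear.bounded[OF bl] by blast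
  have lim: "((\<lambda>y. norm (f y - f z - f' (y - z)) / norm (y - z) * norm (p y) + K * norm (p y - p0)) \<longlongrightarrow>
      0 * norm p0 + K * norm (p0 - p0)) (at z)"
    using f unfolding has_derivative_iff_norm by (intro tendsto_intros p) auto
  show "((\<lambda>y. norm (f y * p y - f z * p z - f' (y - z) * p0) / norm (y - z)) \<longlongrightarrow> 0) (at z)"
  proof (rule tendsto_sandwich[OF _ _ tendsto_const])
    show "\<forall>\<^sub>F y in at z. norm (f y * p y - f z * p z - f' (y - z) * p0) / norm (y - z) \<le>
        norm (f y - f z - f' (y - z)) / norm (y - z) * norm (p y) + K * norm (p y - p0)"
      unfolding eventually_at_filter
    proof (rule always_eventually, intro allI impI)
      fix y assume "y \<noteq> z"
      then have yz: "norm (y - z) > 0" by simp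
      have "f y * p y - f z * p z - f' (y - z) * p0 =
          (f y - f z - f' (y - z)) * p y + f' (y - z) * (p y - p0)"
        using \<open>f z = 0\<close> by (simp add: algebra_simps)
      then have "norm (f y * p y - f z * p z - f' (y - z) * p0) \<le>
          norm (f y - f z - f' (y - z)) * norm (p y) + norm (f' (y - z)) * norm (p y - p0)"
        by (metis norm_mult norm_triangle_ineq)
      also have "\<dots> \<le> norm (f y - f z - f' (y - z)) * norm (p y) + norm (y - z) * K * norm (p y - p0)"
        using K by (intro add_left_mono mult_right_mono) auto
      finally show "norm (f y * p y - f z * p z - f' (y - z) * p0) / norm (y - z) \<le>
        norm (f y - f z - f' (y - z)) / norm (y - z) * norm (p y) + K * norm (p y - p0)"
        using yz by (simp add: field_simps)
    qed
    show "((\<lambda>y. norm (f y - f z - f' (y - z)) / norm (y - z) * norm (p y) + K * norm (p y - p0)) \<longlongrightarrow> 0) (at z)"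
      using lim by simp
  qed simp
qed

text \<open>Here \<open>w\<close> is the disc variable and \<open>z\<close> a parameter. The third
  clause makes every \<open>g\<close> with fixed \<open>z\<close> a strict contraction near its
  fixed point; the fourth is continuity in \<open>z\<close>, uniform in \<open>w\<close>. Holomorphy
  is asked only in each variable separately.\<close>

definition contractive_disc_family :: "(complex ^ 'n) set \<Rightarrow> (complex \<Rightarrow> complex ^ 'n \<Rightarrow> complex) \<Rightarrow> bool" where
  "contractive_disc_family D g \<longleftrightarrow>
     (\<forall>z\<in>D. (\<lambda>w. g w z) holomorphic_on ball 0 1) \<and>
     (\<forall>w. norm w < 1 \<longrightarrow> holomorphic_fun_on (g w) D) \<and>
     (\<forall>z\<in>D. \<exists>r<1. \<forall>w. norm w < 1 \<longrightarrow> norm (g w z) \<le> r) \<and>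
     (\<forall>z\<in>D. \<forall>e>0. \<forall>\<^sub>F y in at z. \<forall>w. norm w < 1 \<longrightarrow> norm (g w y - g w z) \<le> e)"

lemma contractive_disc_familyD:
  assumes "contractive_disc_family D g"
  shows "z \<in> D \<Longrightarrow> (\<lambda>w. g w z) holomorphic_on ball 0 1"
    and "norm w < 1 \<Longrightarrow> holomorphic_fun_on (g w) D"
    and "z \<in> D \<Longrightarrow> \<exists>r<1. \<forall>w. norm w < 1 \<longrightarrow> norm (g w z) \<le> r"
    and "z \<in> D \<Longrightarrow> e > 0 \<Longrightarrow> \<forall>\<^sub>F y in at z. \<forall>w. norm w < 1 \<longrightarrow> norm (g w y - g w z) \<le> e"
  using assms unfolding contractive_disc_family_def by blast+

text \<open>Brouwer gives a fixed point and Schwarz-Pick makes it unique. The contraction estimate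
  also yields continuity of \<open>G\<close>, and differentiability follows by solving the fixed
  point equation for \<open>G y - G z\<close>.\<close>

theorem holomorphic_fixed_point:
  fixes g :: "complex \<Rightarrow> complex ^ 'n \<Rightarrow> complex"
  assumes D: "open D" and fam: "contractive_disc_family D g"
  obtains G where "holomorphic_fun_on G D" "G ` D \<subseteq> ball 0 1"
    "\<And>z w. z \<in> D \<Longrightarrow> norm w < 1 \<Longrightarrow> g w z = w \<Longrightarrow> G z = w"
proof -
  note hol1 = contractive_disc_familyD(1)[OF fam] and hol2 = contractive_disc_familyD(2)[OF fam]
    and bd = contractive_disc_familyD(3)[OF fam] and unif = contractive_disc_familyD(4)[OF fam]
  have "\<exists>w. norm w < 1 \<and> g w z = w" if z: "z \<in> D" for z
  proof -
    obtain r where r: "r < 1" "\<And>w. norm w < 1 \<Longrightarrow> norm (g w z) \<le> r" using bd[OF z] by blast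
    have "r \<ge> 0" using order_trans[OF norm_ge_zero r(2)[of 0]] by simp
    \<comment> \<open>The midpoint of \<open>r\<close> and 1 is positive even for
      \<open>r = 0\<close>, as Brouwer's theorem requires.\<close>
    define R where "R = (1 + r) / 2"
    have R: "0 < R" "R < 1" "r \<le> R" using r(1) \<open>r \<ge> 0\<close> by (auto simp: R_def)
    have "continuous_on (cball 0 R) (\<lambda>w. g w z)"
      using R by (intro continuous_on_subset[OF holomorphic_on_imp_continuous_on[OF hol1[OF z]]]) auto
    moreover have "norm (g w z) \<le> R" if "norm w \<le> R" for w
      using r(2)[of w] that R by simp
    then have "(\<lambda>w. g w z) ` cball 0 R \<subseteq> cball 0 R" by auto
    ultimately obtain w where "w \<in> cball 0 R" "g w z = w"
      using brouwer_ball[OF R(1), of 0 "\<lambda>w. g w z"] by blast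
    then show ?thesis using R by (intro exI[of _ w]) simp
  qed
  then obtain G where G: "\<And>z. z \<in> D \<Longrightarrow> norm (G z) < 1" "\<And>z. z \<in> D \<Longrightarrow> g (G z) z = G z"
    by metis
  have contr: "\<exists>c. 0 < c \<and> c < 1 \<and> norm (deriv (\<lambda>w. g w z) (G z)) \<le> c \<and>
      (\<forall>w. norm w < 1 \<longrightarrow> norm (g w z - G z) * norm (1 - cnj (G z) * w) \<le> c * norm (w - G z) * norm (1 - cnj (G z) * g w z))"
    if z: "z \<in> D" for z
  proof -
    obtain r where r: "r < 1" "\<And>w. norm w < 1 \<Longrightarrow> norm (g w z) \<le> r" using bd[OF z] by blast
    show ?thesis
      by (rule Schwarz_Pick_fixed_point[OF hol1[OF z] r(2) r(1) G(1)[OF z] G(2)[OF z]]) blast+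
  qed
  have nz: "norm (1 - cnj a * w) \<ge> 1 - norm a" "1 - norm a > 0" if "norm a < 1" "norm w < 1" for a w
    using norm_Moebius_function(2)[of a w] that by auto
  have uniq: "G z = w" if z: "z \<in> D" and w: "norm w < 1" "g w z = w" for z w
  proof (rule ccontr)
    assume "G z \<noteq> w"
    then have pos: "norm (w - G z) * norm (1 - cnj (G z) * w) > 0"
      using nz[OF G(1)[OF z] w(1)] by (intro mult_pos_pos) auto
    obtain c where c: "c < 1" "norm (g w z - G z) * norm (1 - cnj (G z) * w) \<le> c * norm (w - G z) * norm (1 - cnj (G z) * g w z)"
      using contr[OF z] w(1) by blast
    then have "norm (w - G z) * norm (1 - cnj (G z) * w) \<le> c * (norm (w - G z) * norm (1 - cnj (G z) * w))"
      using w(2) by (simp add: mult.assoc)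
    with pos c(1) show False by (simp add: mult_le_cancel_right1)
  qed
  have inD: "\<forall>\<^sub>F y in at z. y \<in> D" if "z \<in> D" for z
    using D that by (rule eventually_at_in_open')
  have lim: "(G \<longlongrightarrow> G z) (at z)" if z: "z \<in> D" for z
  proof (rule tendstoI)
    fix \<epsilon> :: real assume \<epsilon>: "\<epsilon> > 0"
    obtain c where c: "0 < c" "c < 1" and ineq: "\<And>w. norm w < 1 \<Longrightarrow>
        norm (g w z - G z) * norm (1 - cnj (G z) * w) \<le> c * norm (w - G z) * norm (1 - cnj (G z) * g w z)"
      using contr[OF z] by blast
    define d where "d = 1 - norm (G z)"
    have d: "d > 0" using G(1)[OF z] by (simp add: d_def)
    \<comment> \<open>The first bound absorbs the perturbation of the denominator, worsening the
      contraction factor from \<open>c\<close> only to \<open>(1 + c) / 2\<close>; the second makes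
      the resulting distance less than \<open>\<epsilon>\<close>.\<close>
    define e where "e = min ((1 - c) * d / 2) (\<epsilon> * (1 - c) / 4)"
    have e: "e > 0" "e \<le> (1 - c) * d / 2" "e \<le> \<epsilon> * (1 - c) / 4" using c d \<epsilon> by (auto simp: e_def)
    have "\<forall>\<^sub>F y in at z. (\<forall>w. norm w < 1 \<longrightarrow> norm (g w y - g w z) \<le> e) \<and> y \<in> D"
      by (intro eventually_conj unif inD z e)
    then show "\<forall>\<^sub>F y in at z. dist (G y) (G z) < \<epsilon>"
    proof eventually_elim
      case (elim y)
      define l where "l = G y"
      have l: "norm l < 1" "g l y = l" using G elim by (auto simp: l_def)
      define v where "v = g l z"
      have v: "norm (l - v) \<le> e" using elim l by (metis v_def)
      define A where "A = norm (1 - cnj (G z) * l)"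
      have A: "A \<ge> d" unfolding A_def d_def by (rule nz[OF G(1)[OF z] l(1)])
      have "1 - cnj (G z) * v = (1 - cnj (G z) * l) + cnj (G z) * (l - v)" by (simp add: algebra_simps)
      then have "norm (1 - cnj (G z) * v) \<le> A + norm (G z) * norm (l - v)"
        unfolding A_def by (metis complex_mod_cnj norm_mult norm_triangle_ineq)
      also have "\<dots> \<le> A + 1 * e" using v G(1)[OF z] by (intro add_left_mono mult_mono) auto
      finally have B: "norm (1 - cnj (G z) * v) \<le> A + e" by simp
      have "norm (v - G z) * A \<le> c * norm (l - G z) * norm (1 - cnj (G z) * v)"
        using ineq[OF l(1)] by (simp add: v_def A_def)
      also have "\<dots> \<le> c * norm (l - G z) * (A + e)"
        using B c by (intro mult_left_mono) auto
      also have "c * (A + e) \<le> (1 + c) / 2 * A"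
      proof -
        have "c * e \<le> 1 * e" using c e by (intro mult_right_mono) auto
        also have "1 * e \<le> (1 - c) / 2 * d" using e(2) by simp
        also have "\<dots> \<le> (1 - c) / 2 * A" using A c by (intro mult_left_mono) auto
        finally show ?thesis by (simp add: algebra_simps)
      qed
      then have "c * norm (l - G z) * (A + e) \<le> norm (l - G z) * ((1 + c) / 2 * A)"
        using mult_left_mono[of "c * (A + e)" "(1 + c) / 2 * A" "norm (l - G z)"] by (simp add: mult_ac)
      finally have "norm (v - G z) * A \<le> (norm (l - G z) * ((1 + c) / 2)) * A" by (simp add: mult_ac)
      then have "norm (v - G z) \<le> norm (l - G z) * ((1 + c) / 2)" using A d by simp
      moreover have "norm (l - G z) \<le> norm (l - v) + norm (v - G z)" by norm
      ultimately have "norm (l - G z) - norm (l - G z) * ((1 + c) / 2) \<le> e" using v by linarith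
      then have "norm (l - G z) * (1 - (1 + c) / 2) \<le> e" by (simp add: right_diff_distrib)
      also have "e \<le> \<epsilon> * (1 - c) / 4" by (rule e)
      also have "\<dots> < \<epsilon> * (1 - (1 + c) / 2)" using c \<epsilon> by (simp add: field_simps)
      finally have "norm (l - G z) < \<epsilon>" using c by (simp add: mult_less_cancel_right)
      then show ?case by (simp add: l_def dist_norm)
    qed
  qed
  have "\<exists>G'. (G has_derivative G') (at z) \<and> (\<forall>a v. G' (a *s v) = a * G' v)" if z: "z \<in> D" for z
  proof -
    define l0 where "l0 = G z"
    have l0: "norm l0 < 1" "g l0 z = l0" using G z by (auto simp: l0_def)
    define q0 where "q0 = deriv (\<lambda>w. g w z) l0"
    have q0: "norm q0 < 1" using contr[OF z] by (auto simp: q0_def l0_def)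
    define Q where "Q y w = (if w = l0 then q0 else (g w y - g l0 y) / (w - l0))" for y w
    define q where "q y = Q y (G y)" for y
    obtain F' where F': "(g l0 has_derivative F') (at z)" "\<And>a v. F' (a *s v) = a * F' v"
      using hol2[OF l0(1)] z by (auto simp: holomorphic_fun_on_def)
    \<comment> \<open>With \<open>q\<close> a difference quotient of \<open>g\<close> in its first argument, the fixed point equation reads
      \<open>(G y - l0) * (1 - q y) = g l0 y - g l0 z\<close>, so only continuity of \<open>q\<close> at \<open>z\<close> is needed.\<close>
    have "isCont (Q z) l0"
    proof -
      have "((\<lambda>w. g w z) has_field_derivative q0) (at l0)"
        unfolding q0_def using l0 by (intro holomorphic_derivI[OF hol1[OF z] open_ball]) simp
      then have "((\<lambda>w. (g w z - g l0 z) / (w - l0)) \<longlongrightarrow> Q z l0) (at l0)"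
        by (simp add: has_field_derivative_iff Q_def)
      then have "(Q z \<longlongrightarrow> Q z l0) (at l0)"
        by (rule Lim_transform_eventually) (auto simp: Q_def eventually_at_filter)
      then show ?thesis by (simp add: isCont_def)
    qed
    then have "((\<lambda>y. Q z (G y)) \<longlongrightarrow> Q z l0) (at z)"
      using lim[OF z] unfolding l0_def by (rule isCont_tendsto_compose)
    then have limQ: "((\<lambda>y. Q z (G y)) \<longlongrightarrow> q0) (at z)" by (simp add: Q_def)
    \<comment> \<open>Off \<open>G y = l0\<close> this is a difference quotient at \<open>l0\<close>
      of the uniformly small function \<open>g w y - g w z\<close> of \<open>w\<close>; at
      \<open>G y = l0\<close> both terms are the default \<open>q0\<close>.\<close>
    have diff: "((\<lambda>y. q y - Q z (G y)) \<longlongrightarrow> 0) (at z)"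
    proof (rule tendstoI)
      fix \<epsilon> :: real assume \<epsilon>: "\<epsilon> > 0"
      define d where "d = 1 - norm l0"
      have d: "d > 0" using l0 by (simp add: d_def)
      have "\<forall>\<^sub>F y in at z. \<forall>w. norm w < 1 \<longrightarrow> norm (g w y - g w z) \<le> \<epsilon> * d / 6"
        using d \<epsilon> by (intro unif z) auto
      moreover have "\<forall>\<^sub>F y in at z. dist (G y) l0 < d / 3"
        using d tendstoD[OF lim[OF z], of "d / 3"] by (simp add: l0_def)
      moreover note inD[OF z]
      ultimately show "\<forall>\<^sub>F y in at z. dist (q y - Q z (G y)) 0 < \<epsilon>"
      proof eventually_elim
        case (elim y)
        have "norm ((g (G y) y - g (G y) z) - (g l0 y - g l0 z)) \<le> 3 * (\<epsilon> * d / 6) / (1 - norm l0) * norm (G y - l0)"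
          by (rule bounded_holomorphic_Lipschitz[of "\<lambda>w. g w y - g w z"])
             (use elim l0 hol1[OF z] hol1[of y] in \<open>auto simp: dist_norm d_def intro!: holomorphic_intros\<close>)
        also have "3 * (\<epsilon> * d / 6) / (1 - norm l0) = \<epsilon> / 2"
          unfolding d_def[symmetric] using d by simp
        finally have le: "norm ((g (G y) y - g (G y) z) - (g l0 y - g l0 z)) \<le> \<epsilon> / 2 * norm (G y - l0)" .
        show ?case
        proof (cases "G y = l0")
          case False
          then have "q y - Q z (G y) = ((g (G y) y - g (G y) z) - (g l0 y - g l0 z)) / (G y - l0)"
            by (simp add: q_def Q_def diff_divide_distrib)
          then have "norm (q y - Q z (G y)) \<le> \<epsilon> / 2"
            using le False by (simp add: norm_divide divide_le_eq)
          then show ?thesis using \<epsilon> by simp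
        qed (use \<epsilon> in \<open>simp add: q_def Q_def\<close>)
      qed
    qed
    from tendsto_add[OF diff limQ] have q: "(q \<longlongrightarrow> q0) (at z)" by simp
    have q1: "1 - q0 \<noteq> 0" using q0 by auto
    then have p: "((\<lambda>y. 1 / (1 - q y)) \<longlongrightarrow> 1 / (1 - q0)) (at z)"
      by (intro tendsto_intros q) auto
    have "((\<lambda>y. g l0 y - g l0 z) has_derivative F') (at z)"
      using has_derivative_diff[OF F'(1) has_derivative_const[of "g l0 z"]] by simp
    from has_derivative_mult_vanishing[OF this _ p]
    have der: "((\<lambda>y. (g l0 y - g l0 z) * (1 / (1 - q y))) has_derivative (\<lambda>v. F' v * (1 / (1 - q0)))) (at z)"
      by simp
    have "((\<lambda>y. l0 + (g l0 y - g l0 z) * (1 / (1 - q y))) has_derivative (\<lambda>v. F' v * (1 / (1 - q0)))) (at z)"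
      using has_derivative_add[OF has_derivative_const[of l0] der] by simp
    moreover have "\<forall>\<^sub>F y in at z. l0 + (g l0 y - g l0 z) * (1 / (1 - q y)) = G y"
    proof -
      have "\<forall>\<^sub>F y in at z. q y \<noteq> 1" using tendsto_imp_eventually_ne[OF q] q1 by auto
      with inD[OF z] show ?thesis
      proof eventually_elim
        case (elim y)
        have "G y - l0 = g (G y) y - g l0 z" using G elim l0 by simp
        also have "\<dots> = q y * (G y - l0) + (g l0 y - g l0 z)"
          by (cases "G y = l0") (simp_all add: q_def Q_def)
        finally have "(G y - l0) * (1 - q y) = g l0 y - g l0 z" by (simp add: algebra_simps)
        then show ?case using elim by (simp add: field_simps)
      qed
    qed
    ultimately have "(G has_derivative (\<lambda>v. F' v * (1 / (1 - q0)))) (at z)"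
      by (rule has_derivative_transform_eventually) (simp_all add: l0_def)
    then show ?thesis using F'(2) by (intro exI[of _ "\<lambda>v. F' v * (1 / (1 - q0))"]) simp
  qed
  then have "holomorphic_fun_on G D" by (simp add: holomorphic_fun_on_def)
  then show ?thesis using G(1) uniq by (intro that[of G]) auto
qed

text \<open>For fixed \<open>z\<close> the values lie in a compact disc of radius
  \<open>r < 1\<close>, on which \<open>S\<close> is bounded away from the circle. On the larger
  disc of radius \<open>R\<close>, which also contains the values for nearby parameters,
  \<open>S\<close> is uniformly continuous.\<close>

lemma contractive_disc_family_compose:
  assumes fam: "contractive_disc_family D g" and S: "S holomorphic_on ball 0 1" "S ` ball 0 1 \<subseteq> ball 0 1"
  shows "contractive_disc_family D (\<lambda>w z. S (g w z))"
  unfolding contractive_disc_family_def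
proof (intro conjI ballI allI impI)
  fix z assume z: "z \<in> D"
  note hol1 = contractive_disc_familyD(1)[OF fam] and hol2 = contractive_disc_familyD(2)[OF fam]
    and unif = contractive_disc_familyD(4)[OF fam]
  obtain r where r: "r < 1" "\<And>w. norm w < 1 \<Longrightarrow> norm (g w z) \<le> r"
    using contractive_disc_familyD(3)[OF fam z] by blast
  have r0: "r \<ge> 0" using order_trans[OF norm_ge_zero r(2)[of 0]] by simp
  have cS: "continuous_on (cball 0 \<rho>) S" if "\<rho> < 1" for \<rho>
    by (rule continuous_on_subset[OF holomorphic_on_imp_continuous_on[OF S(1)]]) (use that in auto)
  have "S \<circ> (\<lambda>w. g w z) holomorphic_on ball 0 1"
    using r by (intro holomorphic_on_compose_gen[OF hol1[OF z] S(1)]) force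
  then show "(\<lambda>w. S (g w z)) holomorphic_on ball 0 1" by (simp add: o_def)
  have "continuous_on (cball 0 r) (\<lambda>w. norm (S w))" by (intro continuous_intros cS r)
  then obtain w0 where w0: "norm w0 \<le> r" "\<And>w. norm w \<le> r \<Longrightarrow> norm (S w) \<le> norm (S w0)"
    using continuous_attains_sup[of "cball 0 r" "\<lambda>w. norm (S w)"] r0 by auto
  then have "norm (S w0) < 1" using S(2) r by force
  then show "\<exists>r<1. \<forall>w. norm w < 1 \<longrightarrow> norm (S (g w z)) \<le> r"
    using w0 r by blast
  fix e :: real assume e: "e > 0"
  define R where "R = (1 + r) / 2"
  have R: "R < 1" "r < R" using r by (auto simp: R_def)
  have "uniformly_continuous_on (cball 0 R) S"
    by (intro compact_uniformly_continuous cS R compact_cball)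
  then obtain d where d: "d > 0" "\<And>x y. norm x \<le> R \<Longrightarrow> norm y \<le> R \<Longrightarrow> dist y x < d \<Longrightarrow> dist (S y) (S x) < e"
    unfolding uniformly_continuous_on_def using e by (metis mem_cball_0)
  have "\<forall>\<^sub>F y in at z. \<forall>w. norm w < 1 \<longrightarrow> norm (g w y - g w z) \<le> min (d / 2) (R - r)"
    using d R by (intro unif z) auto
  then show "\<forall>\<^sub>F y in at z. \<forall>w. norm w < 1 \<longrightarrow> norm (S (g w y) - S (g w z)) \<le> e"
  proof (eventually_elim, intro allI impI)
    fix y and w :: complex
    assume *: "\<forall>w. norm w < 1 \<longrightarrow> norm (g w y - g w z) \<le> min (d / 2) (R - r)" "norm w < 1"
    then have le: "norm (g w y - g w z) \<le> min (d / 2) (R - r)" by blast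
    have "norm (g w y) \<le> norm (g w z) + norm (g w y - g w z)" by norm
    then have "norm (g w y) \<le> R" "norm (g w z) \<le> R" using le r(2)[OF *(2)] R by linarith+
    moreover have "dist (g w y) (g w z) < d" using le d(1) by (simp add: dist_norm)
    ultimately have "dist (S (g w y)) (S (g w z)) < e" by (intro d(2))
    then show "norm (S (g w y) - S (g w z)) \<le> e" by (simp add: dist_norm)
  qed
next
  fix w :: complex assume w: "norm w < 1"
  show "holomorphic_fun_on (\<lambda>z. S (g w z)) D"
    unfolding holomorphic_fun_on_def
  proof
    fix z assume z: "z \<in> D"
    obtain F' where F': "(g w has_derivative F') (at z)" "\<And>c v. F' (c *s v) = c * F' v"
      using contractive_disc_familyD(2)[OF fam w] z by (auto simp: holomorphic_fun_on_def)
    obtain r where r: "r < 1" "norm (g w z) \<le> r"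
      using contractive_disc_familyD(3)[OF fam z] w by blast
    then have "(S has_field_derivative deriv S (g w z)) (at (g w z))"
      by (intro holomorphic_derivI[OF S(1) open_ball]) simp
    then have "((\<lambda>z. S (g w z)) has_derivative (\<lambda>v. deriv S (g w z) * F' v)) (at z)"
      using diff_chain_at[OF F'(1)] by (simp add: has_field_derivative_def o_def)
    then show "\<exists>G'. ((\<lambda>z. S (g w z)) has_derivative G') (at z) \<and> (\<forall>c v. G' (c *s v) = c * G' v)"
      using F'(2) by (intro exI[of _ "\<lambda>v. deriv S (g w z) * F' v"]) simp
  qed
qed

section \<open>Holomorphic functions along curves and the quotient of
  \<open>F (wscale k w z)\<close> by \<open>w\<close>\<close>

lemma holomorphic_fun_on_chain:
  fixes \<gamma> :: "complex \<Rightarrow> complex ^ 'n"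
  assumes F: "(F has_derivative F') (at (\<gamma> \<xi>))" "\<And>c v. F' (c *s v) = c * F' v"
    and \<gamma>: "holomorphic_curve_on \<gamma> U" "open U" "\<xi> \<in> U"
  shows "((\<lambda>w. F (\<gamma> w)) has_field_derivative F' (\<chi> i. deriv (\<lambda>z. \<gamma> z $ i) \<xi>)) (at \<xi>)"
proof -
  define v where "v = (\<chi> i. deriv (\<lambda>z. \<gamma> z $ i) \<xi>)"
  have "(\<gamma> has_derivative (\<lambda>\<eta>. \<eta> *s v)) (at \<xi>)"
    unfolding has_derivative_at_alt
  proof (intro conjI allI impI)
    show "bounded_linear (\<lambda>\<eta>. \<eta> *s v)"
      unfolding linear_conv_bounded_linear[symmetric]
      by (rule linearI) (simp_all add: vec_eq_iff algebra_simps)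
    fix e :: real assume "e > 0"
    from holomorphic_curve_second_order[OF \<gamma> this, folded v_def]
    obtain d where d: "d > 0" "\<And>\<eta>. norm \<eta> < d \<Longrightarrow> norm (\<eta> *s v - (\<gamma> (\<xi> + \<eta>) - \<gamma> \<xi>)) \<le> e * norm \<eta>"
      by (auto simp: eventually_nhds_metric)
    have "norm (\<gamma> y - \<gamma> \<xi> - (y - \<xi>) *s v) \<le> e * norm (y - \<xi>)" if "norm (y - \<xi>) < d" for y
      using d(2)[OF that] norm_minus_commute[of "(y - \<xi>) *s v" "\<gamma> y - \<gamma> \<xi>"] by simp
    with d(1) show "\<exists>d>0. \<forall>y. norm (y - \<xi>) < d \<longrightarrow> norm (\<gamma> y - \<gamma> \<xi> - (y - \<xi>) *s v) \<le> e * norm (y - \<xi>)"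
      by blast
  qed
  from diff_chain_at[OF this F(1)] have "((\<lambda>w. F (\<gamma> w)) has_derivative (\<lambda>\<eta>. \<eta> * F' v)) (at \<xi>)"
    by (simp add: o_def F(2))
  moreover have "(\<lambda>\<eta>. \<eta> * F' v) = (*) (F' v)" by (simp add: fun_eq_iff)
  ultimately show ?thesis unfolding has_field_derivative_def v_def[symmetric] by simp
qed

lemma holomorphic_fun_on_curve:
  assumes F: "holomorphic_fun_on F D" and \<gamma>: "holomorphic_curve_on \<gamma> U" "open U" "\<gamma> ` U \<subseteq> D"
  shows "(\<lambda>w. F (\<gamma> w)) holomorphic_on U"
proof (subst holomorphic_on_open[OF \<gamma>(2)], intro ballI)
  fix \<xi> assume \<xi>: "\<xi> \<in> U"
  then obtain F' where "(F has_derivative F') (at (\<gamma> \<xi>))" "\<And>c v. F' (c *s v) = c * F' v"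
    using F \<gamma>(3) unfolding holomorphic_fun_on_def by blast
  from holomorphic_fun_on_chain[OF this \<gamma>(1,2) \<xi>]
  show "\<exists>f'. ((\<lambda>w. F (\<gamma> w)) has_field_derivative f') (at \<xi>)" by blast
qed

lemma holomorphic_fun_continuous_on: "holomorphic_fun_on F D \<Longrightarrow> continuous_on D F"
  unfolding holomorphic_fun_on_def
  by (meson continuous_at_imp_continuous_on has_derivative_continuous)

text \<open>Schwarz's lemma for \<open>N / e\<close>. It serves twice: for one function it gives the
  strict bound on the quotient, for a difference of two the continuity in the parameter.\<close>

lemma Schwarz_quotient_bound:
  assumes hol: "N holomorphic_on ball 0 1" and "N 0 = 0" and bd: "\<And>w. norm w < 1 \<Longrightarrow> norm (N w) < e"
    and w: "norm w < 1"
  shows "norm (if w = 0 then deriv N 0 else N w / w) \<le> e"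
proof -
  have e: "e > 0" using bd[of 0] \<open>N 0 = 0\<close> by simp
  have hol': "(\<lambda>w. N w / of_real e) holomorphic_on ball 0 1"
    using hol e by (intro holomorphic_intros) auto
  have bd': "norm (N w / of_real e) < 1" if "norm w < 1" for w
    using bd[OF that] e by (simp add: norm_divide)
  note Sch = Schwarz_Lemma(1,2)[OF hol' _ bd' w]
  have "N field_differentiable at 0" using hol by (simp add: holomorphic_on_imp_differentiable_at)
  then have "deriv (\<lambda>w. N w / of_real e) 0 = deriv N 0 / of_real e"
    by (intro DERIV_imp_deriv DERIV_cdivide field_differentiable_derivI)
  then have "norm (deriv N 0 / of_real e) \<le> 1" using Sch(2) \<open>N 0 = 0\<close> by simp
  then show ?thesis
    using Sch(1) \<open>N 0 = 0\<close> e by (auto simp: norm_divide field_simps)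
qed

lemma holomorphic_curve_on_wscale_const: "holomorphic_curve_on (\<lambda>w. wscale k w z) U"
  by (auto simp: holomorphic_curve_on_def intro!: holomorphic_intros)

text \<open>The scaled points \<open>wscale k w z\<close> with \<open>norm w \<le> 1\<close> form a
  compact subset of \<open>D\<close>, so \<open>norm (F ...)\<close> has a maximum below 1 on it and
  Schwarz's lemma passes this bound to \<open>H\<close>. Compactness of the closed disc also gives,
  by the tube lemma, closeness for nearby parameters uniformly in \<open>w\<close>.\<close>

lemma weighted_homogeneous_quotient:
  fixes F :: "complex ^ 'n \<Rightarrow> complex"
  assumes D: "open D" and bal: "k_balanced k D" and k: "\<And>i. k i \<ge> 1" and D0: "0 \<in> D"
    and F: "holomorphic_fun_on F D" "F ` D \<subseteq> ball 0 1" "F 0 = 0"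
  defines "H \<equiv> \<lambda>w z. if w = 0 then deriv (\<lambda>w. F (wscale k w z)) 0 else F (wscale k w z) / w"
  shows "contractive_disc_family D H"
  unfolding contractive_disc_family_def
proof (intro conjI ballI allI impI)
  have contF: "continuous_on D F" by (rule holomorphic_fun_continuous_on[OF F(1)])
  have at0: "F (wscale k 0 z) = 0" for z using wscale_zero[of k z, OF k] F(3) by simp
  have contw: "continuous_on UNIV (\<lambda>w. wscale k w z)" for z by (intro continuous_intros)
  fix z assume z: "z \<in> D"
  define \<Omega> where "\<Omega> y = (\<lambda>w. wscale k w y) -` D" for y
  have \<Omega>: "open (\<Omega> y)" for y unfolding \<Omega>_def by (intro open_vimage D contw)
  have hol\<Omega>: "(\<lambda>w. F (wscale k w y)) holomorphic_on \<Omega> y" for y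
    by (rule holomorphic_fun_on_curve[OF F(1) holomorphic_curve_on_wscale_const \<Omega>]) (auto simp: \<Omega>_def)
  have sub: "cball 0 1 \<subseteq> \<Omega> y" if "y \<in> D" for y
    using k_balancedD[OF bal _ that] by (auto simp: \<Omega>_def)
  have hol: "(\<lambda>w. F (wscale k w y)) holomorphic_on ball 0 1" if "y \<in> D" for y
    using sub[OF that] ball_subset_cball by (intro holomorphic_on_subset[OF hol\<Omega>[of y]]) blast
  obtain h where h: "h holomorphic_on ball 0 1" "\<And>w. norm w < 1 \<Longrightarrow> F (wscale k w z) = w * h w"
      "deriv (\<lambda>w. F (wscale k w z)) 0 = h 0"
    using Schwarz3[OF hol[OF z] at0] by blast
  have "(\<lambda>w. H w z) holomorphic_on ball 0 1"
    by (rule holomorphic_transform[OF h(1)]) (use h in \<open>auto simp: H_def\<close>)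
  then show "(\<lambda>w. H w z) holomorphic_on ball 0 1" .
  have "continuous_on (cball 0 1) (\<lambda>w. norm (F (wscale k w z)))"
    using sub[OF z] by (intro continuous_on_norm continuous_on_subset[OF holomorphic_on_imp_continuous_on[OF hol\<Omega>]])
  then obtain w0 where w0: "norm w0 \<le> 1" "\<And>w. norm w \<le> 1 \<Longrightarrow> norm (F (wscale k w z)) \<le> norm (F (wscale k w0 z))"
    using continuous_attains_sup[of "cball 0 1" "\<lambda>w. norm (F (wscale k w z))"] by auto
  have "norm (F (wscale k w0 z)) < 1"
    using F(2) k_balancedD[OF bal w0(1) z] by auto
  then obtain r where r: "norm (F (wscale k w0 z)) < r" "r < 1" using dense by blast
  have "norm (H w z) \<le> r" if "norm w < 1" for w
    unfolding H_def by (rule Schwarz_quotient_bound[OF hol[OF z] at0 _ that]) (intro le_less_trans[OF w0(2) r(1)] less_imp_le)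
  then show "\<exists>r<1. \<forall>w. norm w < 1 \<longrightarrow> norm (H w z) \<le> r" using r(2) by blast
  fix e :: real assume e: "e > 0"
  define \<Omega>2 where "\<Omega>2 = (\<lambda>(y, w). wscale k w y) -` D \<inter> (\<lambda>(y, w). wscale k w z) -` D"
  have \<Omega>2: "open \<Omega>2"
    unfolding \<Omega>2_def case_prod_unfold by (intro open_Int open_vimage D continuous_intros)
  define \<Delta> where "\<Delta> = (\<lambda>(y, w). norm (F (wscale k w y) - F (wscale k w z)))"
  have "continuous_on \<Omega>2 \<Delta>"
    unfolding \<Delta>_def case_prod_unfold
    by (intro continuous_intros continuous_on_compose2[OF contF]) (auto simp: \<Omega>2_def)
  then have W: "open (\<Omega>2 \<inter> \<Delta> -` {..<e})"
    by (rule continuous_open_preimage[OF _ \<Omega>2 open_lessThan])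
  have "{z} \<times> cball 0 1 \<subseteq> \<Omega>2 \<inter> \<Delta> -` {..<e}"
    using k_balancedD[OF bal _ z] e by (auto simp: \<Omega>2_def \<Delta>_def)
  then obtain X where X: "z \<in> X" "open X" "X \<times> cball 0 1 \<subseteq> \<Omega>2 \<inter> \<Delta> -` {..<e}"
    using Elementary_Topology.tube_lemma[OF compact_cball W] by metis
  have "\<forall>\<^sub>F y in at z. y \<in> X \<inter> D"
    using X D z by (intro eventually_at_in_open') auto
  then show "\<forall>\<^sub>F y in at z. \<forall>w. norm w < 1 \<longrightarrow> norm (H w y - H w z) \<le> e"
  proof (eventually_elim, intro allI impI)
    fix y and w :: complex assume y: "y \<in> X \<inter> D" and w: "norm w < 1"
    let ?N = "\<lambda>w. F (wscale k w y) - F (wscale k w z)"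
    have "norm (if w = 0 then deriv ?N 0 else ?N w / w) \<le> e"
    proof (rule Schwarz_quotient_bound[OF _ _ _ w])
      show "?N holomorphic_on ball 0 1" using y z by (intro holomorphic_intros hol) auto
      fix w :: complex assume "norm w < 1"
      then have "(y, w) \<in> X \<times> cball 0 1" using y by simp
      then have "(y, w) \<in> \<Delta> -` {..<e}" using X(3) by blast
      then show "norm (?N w) < e" by (simp add: \<Delta>_def)
    qed (simp add: at0)
    moreover have "deriv ?N 0 = deriv (\<lambda>w. F (wscale k w y)) 0 - deriv (\<lambda>w. F (wscale k w z)) 0"
      using y z by (intro deriv_diff holomorphic_on_imp_differentiable_at[OF hol]) auto
    ultimately show "norm (H w y - H w z) \<le> e"
      by (cases "w = 0") (auto simp: H_def diff_divide_distrib)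
  qed
next
  fix w :: complex assume w: "norm w < 1"
  show "holomorphic_fun_on (H w) D"
    unfolding holomorphic_fun_on_def
  proof
    fix z assume z: "z \<in> D"
    show "\<exists>G'. (H w has_derivative G') (at z) \<and> (\<forall>c v. G' (c *s v) = c * G' v)"
    proof (cases "w = 0")
      case True
      obtain F' where F': "(F has_derivative F') (at 0)" "\<And>c v. F' (c *s v) = c * F' v"
        using F(1) D0 unfolding holomorphic_fun_on_def by blast
      \<comment> \<open>At \<open>w = 0\<close> the derivative of \<open>w ^ k i * z $ i\<close>
        survives only for weight 1. Hence \<open>H 0\<close> is the complex-linear map
        \<open>F'\<close> after this projection.\<close>
      define L :: "complex ^ 'n \<Rightarrow> complex ^ 'n" where "L z = (\<chi> i. if k i = 1 then z $ i else 0)" for z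
      have dz: "deriv (\<lambda>w. w ^ k i * c) 0 = (if k i = 1 then c else 0)" for i and c :: complex
      proof -
        have "((\<lambda>w. w ^ k i * c) has_field_derivative (of_nat (k i) * 0 ^ (k i - 1) * c)) (at 0)"
          by (auto intro!: derivative_eq_intros)
        then have "deriv (\<lambda>w. w ^ k i * c) 0 = of_nat (k i) * 0 ^ (k i - 1) * c" by (rule DERIV_imp_deriv)
        then show ?thesis using k[of i] by (auto simp: power_0_left)
      qed
      have H: "H w = (\<lambda>z. F' (L z))"
      proof
        fix z
        have "((\<lambda>w. F (wscale k w z)) has_field_derivative F' (\<chi> i. deriv (\<lambda>w. wscale k w z $ i) 0)) (at 0)"
          by (rule holomorphic_fun_on_chain[OF _ F'(2) holomorphic_curve_on_wscale_const[of k z UNIV]])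
             (use F'(1) wscale_zero[of k z, OF k] in auto)
        then show "H w z = F' (L z)" using True by (simp add: H_def L_def dz DERIV_imp_deriv)
      qed
      have bl: "bounded_linear F'" using F'(1) by (rule has_derivative_bounded_linear)
      have "bounded_linear (\<lambda>z. F' (L z))"
      proof (rule bounded_linear_compose[OF bl])
        show "bounded_linear L" by (rule bounded_linearI') (auto simp: L_def vec_eq_iff)
      qed
      then have "(H w has_derivative (\<lambda>z. F' (L z))) (at z)" unfolding H by (rule bounded_linear_imp_has_derivative)
      moreover have "F' (L (c *s v)) = c * F' (L v)" for c v
      proof -
        have "L (c *s v) = c *s L v" by (auto simp: L_def vec_eq_iff)
        then show ?thesis by (simp add: F'(2))
      qed
      ultimately show ?thesis by blast
    next
      case False
      obtain F' where F': "(F has_derivative F') (at (wscale k w z))" "\<And>c v. F' (c *s v) = c * F' v"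
        using F(1) k_balancedD[OF bal less_imp_le[OF w] z] unfolding holomorphic_fun_on_def by blast
      have "bounded_linear (wscale k w)"
        by (rule bounded_linearI') (auto simp: vec_eq_iff algebra_simps)
      then have "(wscale k w has_derivative wscale k w) (at z)" by (rule bounded_linear_imp_has_derivative)
      from diff_chain_at[OF this F'(1)]
      have "((\<lambda>z. F (wscale k w z)) has_derivative (\<lambda>v. F' (wscale k w v))) (at z)" by (simp add: o_def)
      from bounded_linear.has_derivative[OF bounded_linear_divide[of w] this]
      have "(H w has_derivative (\<lambda>v. F' (wscale k w v) / w)) (at z)"
        using False by (simp add: H_def)
      moreover have "F' (wscale k w (c *s v)) / w = c * (F' (wscale k w v) / w)" for c v
      proof -
        have "wscale k w (c *s v) = c *s wscale k w v" by (auto simp: vec_eq_iff)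
        then show ?thesis by (simp add: F'(2))
      qed
      ultimately show ?thesis by blast
    qed
  qed
qed

subsection \<open>Factors of Blaschke products\<close>

lemma Moebius_denominator_nonzero: "norm a < 1 \<Longrightarrow> norm z < 1 \<Longrightarrow> 1 - cnj a * z \<noteq> (0::complex)"
  using norm_Moebius_function(2)[of a z] by fastforce

lemma Moebius_of_quotient:
  assumes "Q \<noteq> (0::complex)"
  shows "Moebius_function 0 b (P / Q) = (P - b * Q) / (Q - cnj b * P)"
proof -
  have "P / Q - b = (P - b * Q) / Q" "1 - cnj b * (P / Q) = (Q - cnj b * P) / Q"
    using assms by (simp_all add: field_simps)
  then show ?thesis using assms by (simp add: Moebius_function_simple)
qed

lemma unimodular_mult_cnj: "norm \<zeta> = 1 \<Longrightarrow> \<zeta> * cnj \<zeta> = 1"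
  by (metis complex_norm_square mult.commute of_real_1 one_power2)

lemma norm_divide_cnj: "norm \<zeta> = 1 \<Longrightarrow> u \<noteq> 0 \<Longrightarrow> norm (u / (\<zeta> * cnj u)) = 1"
  by (simp add: norm_divide norm_mult)

text \<open>The composition is again a disc automorphism and vanishes at \<open>\<alpha>\<close>.
  With \<open>u\<close> the coefficient of \<open>z\<close> in the cleared numerator, the constant
  can be read off explicitly.\<close>

lemma Moebius_Blaschke_degree_one:
  assumes \<alpha>: "norm \<alpha> < 1" and a: "norm a < 1" and \<zeta>: "norm \<zeta> = 1"
    and B: "\<And>z. norm z < 1 \<Longrightarrow> B z = \<zeta> * Moebius_function 0 a z"
    and b: "norm (B \<alpha>) < 1"
  obtains c where "norm c = 1"
    "\<And>z. norm z < 1 \<Longrightarrow> Moebius_function 0 (B \<alpha>) (B z) = Moebius_function 0 \<alpha> z * c"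
proof -
  define b where "b = B \<alpha>"
  define u where "u = \<zeta> + b * cnj a"
  have \<zeta>2: "\<zeta> * cnj \<zeta> = 1" using \<zeta> by (rule unimodular_mult_cnj)
  have nz: "1 - cnj x * z \<noteq> 0" if "norm x < 1" "norm z < 1" for x z :: complex
    using that by (rule Moebius_denominator_nonzero)
  have rel: "\<zeta> * (\<alpha> - a) = b * (1 - cnj a * \<alpha>)"
    using B[OF \<alpha>] nz[OF a \<alpha>] by (simp add: b_def Moebius_function_simple)
  \<comment> \<open>The algebraic simplification treats a number and its conjugate as independent,
    so the conjugated relation is needed separately for the denominator.\<close>
  have "cnj (\<zeta> * (\<alpha> - a)) = cnj (b * (1 - cnj a * \<alpha>))" by (simp only: rel)
  then have rel': "cnj \<zeta> * (cnj \<alpha> - cnj a) = cnj b * (1 - a * cnj \<alpha>)" by simp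
  have u': "cnj u = cnj \<zeta> + cnj b * a" by (simp add: u_def)
  have "norm (b * cnj a) < 1"
    using norm_mult_less[of b 1 "cnj a" 1] b a by (simp add: b_def)
  then have u0: "u \<noteq> 0" unfolding u_def using \<zeta> by (metis add_eq_0_iff norm_minus_cancel less_irrefl)
  show ?thesis
  proof (rule that[of "u / (\<zeta> * cnj u)"])
    show "norm (u / (\<zeta> * cnj u)) = 1" by (rule norm_divide_cnj[OF \<zeta> u0])
    fix z :: complex assume z: "norm z < 1"
    have "\<zeta> * (z - a) - b * (1 - cnj a * z) = u * (z - \<alpha>)"
      using rel unfolding u_def by algebra
    moreover have "(1 - cnj a * z) - cnj b * (\<zeta> * (z - a)) = \<zeta> * cnj u * (1 - cnj \<alpha> * z)"
      using rel' \<zeta>2 unfolding u' by algebra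
    moreover have "B z = \<zeta> * (z - a) / (1 - cnj a * z)" using B[OF z] by (simp add: Moebius_function_simple)
    ultimately show "Moebius_function 0 (B \<alpha>) (B z) = Moebius_function 0 \<alpha> z * (u / (\<zeta> * cnj u))"
      using Moebius_of_quotient[OF nz[OF a z], of b "\<zeta> * (z - a)"]
      by (simp add: b_def[symmetric] Moebius_function_simple mult_ac)
  qed
qed

text \<open>The cleared numerator is a quadratic with root \<open>\<alpha>\<close>, so it splits off
  \<open>z - \<alpha>\<close> and leaves \<open>u * z + v\<close>; the denominator leaves the
  reflected factor. If \<open>norm v < norm u\<close>, the rest is a rotated Moebius function; if
  the norms agree, it collapses to a unimodular constant.\<close>

lemma Moebius_Blaschke_degree_two:
  assumes \<alpha>: "norm \<alpha> < 1" and a: "norm a < 1" and d: "norm d < 1" and \<zeta>: "norm \<zeta> = 1"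
    and B: "\<And>z. norm z < 1 \<Longrightarrow> B z = \<zeta> * (Moebius_function 0 a z * Moebius_function 0 d z)"
    and b: "norm (B \<alpha>) < 1"
  obtains c where "norm c = 1"
    "\<And>z. norm z < 1 \<Longrightarrow> Moebius_function 0 (B \<alpha>) (B z) = Moebius_function 0 \<alpha> z * c"
  | c \<beta> where "norm c = 1" "norm \<beta> < 1"
    "\<And>z. norm z < 1 \<Longrightarrow> Moebius_function 0 (B \<alpha>) (B z) = Moebius_function 0 \<alpha> z * (c * Moebius_function 0 \<beta> z)"
proof -
  define b where "b = B \<alpha>"
  define u where "u = \<zeta> - b * cnj a * cnj d"
  define v where "v = \<alpha> * u - \<zeta> * (a + d) + b * (cnj a + cnj d)"
  have \<zeta>2: "\<zeta> * cnj \<zeta> = 1" using \<zeta> by (rule unimodular_mult_cnj)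
  have nz: "1 - cnj x * z \<noteq> 0" if "norm x < 1" "norm z < 1" for x z :: complex
    using that by (rule Moebius_denominator_nonzero)
  have rel: "\<zeta> * (\<alpha> - a) * (\<alpha> - d) = b * (1 - cnj a * \<alpha>) * (1 - cnj d * \<alpha>)"
    using B[OF \<alpha>] nz[OF a \<alpha>] nz[OF d \<alpha>] by (simp add: b_def Moebius_function_simple)
  have "cnj (\<zeta> * (\<alpha> - a) * (\<alpha> - d)) = cnj (b * (1 - cnj a * \<alpha>) * (1 - cnj d * \<alpha>))" by (simp only: rel)
  then have rel': "cnj \<zeta> * (cnj \<alpha> - cnj a) * (cnj \<alpha> - cnj d) = cnj b * (1 - a * cnj \<alpha>) * (1 - d * cnj \<alpha>)" by simp
  have u': "cnj u = cnj \<zeta> - cnj b * a * d" by (simp add: u_def)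
  have v': "cnj v = cnj \<alpha> * (cnj \<zeta> - cnj b * a * d) - cnj \<zeta> * (cnj a + cnj d) + cnj b * (a + d)" by (simp add: v_def u')
  have b1: "norm b < 1" using b by (simp add: b_def)
  have "norm (b * cnj a * cnj d) < 1"
    using norm_mult_less[OF norm_mult_less[of b 1 "cnj a" 1], of "cnj d" 1] b1 a d by simp
  then have u0: "u \<noteq> 0" unfolding u_def using \<zeta> by auto
  define P where "P z = \<zeta> * (z - a) * (z - d)" for z
  define Q where "Q z = (1 - cnj a * z) * (1 - cnj d * z)" for z
  have num: "P z - b * Q z = (z - \<alpha>) * (u * z + v)" for z
    using rel unfolding P_def Q_def v_def u_def by algebra
  have den: "Q z - cnj b * P z = \<zeta> * ((1 - cnj \<alpha> * z) * (cnj u + cnj v * z))" for z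
    using rel' \<zeta>2 unfolding P_def Q_def v' u' by algebra
  have Q0: "Q z \<noteq> 0" if "norm z < 1" for z using nz[OF a that] nz[OF d that] by (simp add: Q_def)
  have BPQ: "B z = P z / Q z" if "norm z < 1" for z
    using B[OF that] by (simp add: P_def Q_def Moebius_function_simple)
  have den0: "cnj u + cnj v * z \<noteq> 0" if z: "norm z < 1" for z
  proof
    assume "cnj u + cnj v * z = 0"
    then have "Q z = cnj b * P z" using den[of z] by simp
    then have "cnj b * B z = 1" using BPQ[OF z] Q0[OF z] by (simp add: field_simps)
    moreover have "norm (B z) < 1"
      using B[OF z] norm_mult_less[OF Moebius_function_norm_lt_1[OF a z] Moebius_function_norm_lt_1[OF d z]]
      by (simp add: norm_mult \<zeta>)
    ultimately show False using b1 norm_mult_less[of "cnj b" 1 "B z" 1] by simp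
  qed
  have main: "Moebius_function 0 (B \<alpha>) (B z) = Moebius_function 0 \<alpha> z * ((u * z + v) / (\<zeta> * (cnj u + cnj v * z)))"
    if z: "norm z < 1" for z
    using Moebius_of_quotient[OF Q0[OF z], of b "P z"] BPQ[OF z] num[of z] den[of z]
    by (simp add: b_def[symmetric] Moebius_function_simple mult_ac)
  \<comment> \<open>Otherwise the zero \<open>- cnj u / cnj v\<close> of the denominator would lie
    in the disc.\<close>
  have "norm v \<le> norm u"
  proof (rule ccontr)
    assume "\<not> norm v \<le> norm u"
    then have "norm (- cnj u / cnj v) < 1" "v \<noteq> 0" by (auto simp: norm_divide divide_less_eq)
    then show False using den0[of "- cnj u / cnj v"] by simp
  qed
  then consider "norm v = norm u" | "norm v < norm u" by linarith
  then show ?thesis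
  proof cases
    case 1
    then have v0: "v \<noteq> 0" using u0 by auto
    have uv: "u * cnj u = v * cnj v" using 1 by (metis complex_norm_square)
    show ?thesis
    proof (rule that(1)[of "u / (\<zeta> * cnj v)"])
      show "norm (u / (\<zeta> * cnj v)) = 1" using 1 u0 v0 by (simp add: norm_divide norm_mult \<zeta>)
      fix z :: complex assume z: "norm z < 1"
      have "(u * z + v) * (\<zeta> * cnj v) = u * (\<zeta> * (cnj u + cnj v * z))" using uv by algebra
      then have "(u * z + v) / (\<zeta> * (cnj u + cnj v * z)) = u / (\<zeta> * cnj v)"
        using den0[OF z] v0 \<zeta>2 by (subst frac_eq_eq) auto
      then show "Moebius_function 0 (B \<alpha>) (B z) = Moebius_function 0 \<alpha> z * (u / (\<zeta> * cnj v))"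
        using main[OF z] by simp
    qed
  next
    case 2
    show ?thesis
    proof (rule that(2)[of "u / (\<zeta> * cnj u)" "- v / u"])
      show "norm (u / (\<zeta> * cnj u)) = 1" by (rule norm_divide_cnj[OF \<zeta> u0])
      show "norm (- v / u) < 1" using 2 u0 by (simp add: norm_divide divide_less_eq)
      fix z :: complex assume z: "norm z < 1"
      have "u * z + v = u * (z - (- v / u))" "cnj u + cnj v * z = cnj u * (1 - cnj (- v / u) * z)"
        using u0 by (simp_all add: field_simps)
      then show "Moebius_function 0 (B \<alpha>) (B z) =
          Moebius_function 0 \<alpha> z * (u / (\<zeta> * cnj u) * Moebius_function 0 (- v / u) z)"
        unfolding main[OF z] by (simp add: Moebius_function_simple)
    qed
  qed
qed

lemma finite_Blaschke_product_le_2E: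
  assumes "finite_Blaschke_product s B" "s \<le> 2"
  obtains \<zeta> where "norm \<zeta> = 1" "\<And>z. norm z < 1 \<Longrightarrow> B z = \<zeta>"
  | \<zeta> a where "s = 1" "norm \<zeta> = 1" "norm a < 1" "\<And>z. norm z < 1 \<Longrightarrow> B z = \<zeta> * Moebius_function 0 a z"
  | \<zeta> a d where "s = 2" "norm \<zeta> = 1" "norm a < 1" "norm d < 1"
      "\<And>z. norm z < 1 \<Longrightarrow> B z = \<zeta> * (Moebius_function 0 a z * Moebius_function 0 d z)"
proof -
  obtain \<zeta> \<beta> where B: "norm \<zeta> = 1" "\<And>j. j < s \<Longrightarrow> norm (\<beta> j) < 1"
      "\<And>z. norm z < 1 \<Longrightarrow> B z = \<zeta> * (\<Prod>j<s. Moebius_function 0 (\<beta> j) z)"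
    using assms(1) unfolding finite_Blaschke_product_def mem_ball_0 Ball_def by blast
  consider "s = 0" | "s = 1" | "s = 2" using assms(2) by linarith
  then show ?thesis
  proof cases
    case 1 then show ?thesis using B by (intro that(1)[of \<zeta>]) auto
  next
    case 2 then show ?thesis using B by (intro that(2)[of \<zeta> "\<beta> 0"]) auto
  next
    case 3 then show ?thesis using B
      by (intro that(3)[of \<zeta> "\<beta> 0" "\<beta> 1"]) (auto simp: numeral_2_eq_2 lessThan_Suc mult_ac)
  qed
qed

lemma holomorphic_fun_on_Moebius:
  assumes F: "holomorphic_fun_on F D" "F ` D \<subseteq> ball 0 1" and b: "norm b < 1"
  shows "holomorphic_fun_on (\<lambda>z. Moebius_function 0 b (F z)) D"
  unfolding holomorphic_fun_on_def
proof
  fix z assume z: "z \<in> D"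
  obtain F' where F': "(F has_derivative F') (at z)" "\<And>c v. F' (c *s v) = c * F' v"
    using F z unfolding holomorphic_fun_on_def by blast
  define m' where "m' = deriv (Moebius_function 0 b) (F z)"
  have "(Moebius_function 0 b has_field_derivative m') (at (F z))"
    unfolding m'_def using F(2) z
    by (intro holomorphic_derivI[OF Moebius_function_holomorphic[OF b] open_ball]) auto
  then have "((\<lambda>z. Moebius_function 0 b (F z)) has_derivative (\<lambda>v. m' * F' v)) (at z)"
    using diff_chain_at[OF F'(1)] by (simp add: has_field_derivative_def o_def)
  then show "\<exists>G'. ((\<lambda>z. Moebius_function 0 b (F z)) has_derivative G') (at z) \<and> (\<forall>c v. G' (c *s v) = c * G' v)"
    using F'(2) by (intro exI[of _ "\<lambda>v. m' * F' v"]) simp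
qed

section \<open>Geodesics and division by the Moebius factor\<close>

theorem proposition3p5:
  fixes D :: "(complex ^ 'n) set"
    and k :: "'n \<Rightarrow> nat"
    and f \<phi> :: "complex \<Rightarrow> complex ^ 'n"
    and \<alpha> :: complex
  assumes "domain_Cn D"
    and "\<And>i. k i \<ge> 1"
    and "k_balanced k D"
    and "pseudoconvex D"
    and "l_geodesic 3 D f"
    and "\<alpha> \<in> ball 0 1"
    and "holomorphic_curve_on \<phi> (ball 0 1)"
    and "\<And>z. z \<in> ball 0 1 \<Longrightarrow> f z = (\<chi> i. Moebius_function 0 \<alpha> z ^ k i * \<phi> z $ i)"
  shows "(l_geodesic 2 D \<phi> \<or> \<phi> ` ball 0 1 \<subseteq> frontier D) \<and>
         (l_geodesic 2 D f \<longrightarrow> \<phi> ` ball 0 1 \<subseteq> frontier D)"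
proof -
  note k = assms(2) and bal = assms(3) and pc = assms(4) and hol = assms(7)
  let ?m = "Moebius_function 0"
  have D: "open D" "D \<noteq> {}" using assms(1) by (auto simp: domain_Cn_def)
  have D0: "0 \<in> D" by (rule k_balanced_zero[OF bal D(2) k])
  have \<alpha>: "norm \<alpha> < 1" using assms(6) by simp
  have f: "f z = wscale k (?m \<alpha> z) (\<phi> z)" if "norm z < 1" for z
    using assms(8)[of z] that by (simp add: wscale_def)
  have fD: "f z \<in> D" if "norm z < 1" for z
    using assms(5) that by (force simp: l_geodesic_def)
  then have dich: "\<phi> ` ball 0 1 \<subseteq> D \<or> \<phi> ` ball 0 1 \<subseteq> frontier D"
    using f by (intro Moebius_quotient_dichotomy[of D k \<alpha>, OF pc bal k \<alpha> hol]) simp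
  have f\<alpha>: "f \<alpha> = 0" using f[OF \<alpha>] wscale_zero[of k "\<phi> \<alpha>", OF k] by (simp add: Moebius_function_eq_zero)
  have m_nz: "?m \<alpha> z \<noteq> 0" if "norm z < 1" "z \<noteq> \<alpha>" for z
    using that Moebius_denominator_nonzero[OF \<alpha>] by (simp add: Moebius_function_simple)
  have m_lt: "norm (?m \<alpha> z) < 1" if "norm z < 1" for z
    using \<alpha> that by (rule Moebius_function_norm_lt_1)
  \<comment> \<open>A point where the Moebius factor does not vanish; it tests the modulus of
    \<open>H\<close> and later the non-constancy.\<close>
  obtain z1 where z1: "norm z1 < 1" "z1 \<noteq> \<alpha>"
  proof (cases "\<alpha> = 0")
    case True then show ?thesis by (intro that[of "1 / 2"]) auto
  next
    case False then show ?thesis by (intro that[of 0]) auto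
  qed
  \<comment> \<open>Normalising by the Moebius function at \<open>F 0\<close> gives a function
    vanishing at 0. Scaling \<open>\<phi> z\<close> by \<open>?m \<alpha> z\<close> returns
    \<open>f z\<close>, which identifies \<open>H\<close> there; at \<open>z = \<alpha>\<close> the
    quotient is undefined and \<open>H\<close> is a derivative.\<close>
  have key: "\<exists>H. contractive_disc_family D H \<and> (\<forall>z. norm z < 1 \<longrightarrow> z \<noteq> \<alpha> \<longrightarrow>
      H (?m \<alpha> z) (\<phi> z) = ?m (F 0) (F (f z)) / ?m \<alpha> z)"
    if F: "holomorphic_fun_on F D" "F ` D \<subseteq> ball 0 1" for F
  proof -
    have b: "norm (F 0) < 1" using F(2) D0 by auto
    define F0 where "F0 z = ?m (F 0) (F z)" for z
    have "holomorphic_fun_on F0 D" unfolding F0_def by (rule holomorphic_fun_on_Moebius[OF F b])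
    moreover have "F0 ` D \<subseteq> ball 0 1"
      using F(2) Moebius_function_norm_lt_1[OF b] by (force simp: F0_def)
    moreover have "F0 0 = 0" by (simp add: F0_def Moebius_function_eq_zero)
    ultimately have "contractive_disc_family D (\<lambda>w z. if w = 0 then deriv (\<lambda>w. F0 (wscale k w z)) 0 else F0 (wscale k w z) / w)"
      by (intro weighted_homogeneous_quotient D bal k D0)
    then show ?thesis using f m_nz by (intro exI conjI) (auto simp: F0_def)
  qed
  \<comment> \<open>A unimodular constant would give \<open>H\<close> modulus 1 at
    \<open>z1\<close>, against the strict bound at \<open>\<phi> z1\<close> in
    \<open>D\<close>.\<close>
  have no_const: False
    if F: "holomorphic_fun_on F D" "F ` D \<subseteq> ball 0 1" and sub: "\<phi> ` ball 0 1 \<subseteq> D"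
      and c: "norm c = 1" "\<And>z. norm z < 1 \<Longrightarrow> ?m (F 0) (F (f z)) = ?m \<alpha> z * c" for F c
  proof -
    obtain H where H: "contractive_disc_family D H"
      "H (?m \<alpha> z1) (\<phi> z1) = ?m (F 0) (F (f z1)) / ?m \<alpha> z1"
      using key[OF F] z1 by blast
    have "norm (H (?m \<alpha> z1) (\<phi> z1)) = 1" using H(2) c z1 m_nz[OF z1] by simp
    moreover have "\<phi> z1 \<in> D" using sub z1 by auto
    ultimately show False using contractive_disc_familyD(3)[OF H(1)] m_lt[OF z1(1)] by force
  qed
  have geo: "l_geodesic 2 D \<phi>" if "\<phi> ` ball 0 1 \<subseteq> D"
  proof -
    note sub = that
    obtain F s where F: "holomorphic_fun_on F D" "F ` D \<subseteq> ball 0 1" and s: "s \<le> 2" "finite_Blaschke_product s (F \<circ> f)"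
      using assms(5) by (auto simp: l_geodesic_def)
    have b: "norm ((F \<circ> f) \<alpha>) < 1" using F(2) D0 f\<alpha> by auto
    have F0: "(F \<circ> f) \<alpha> = F 0" using f\<alpha> by simp
    obtain c \<beta> where c: "norm c = 1" and \<beta>: "norm \<beta> < 1"
      and fac: "\<And>z. norm z < 1 \<Longrightarrow> ?m (F 0) (F (f z)) = ?m \<alpha> z * (c * ?m \<beta> z)"
      using s(2,1)
    proof (cases rule: finite_Blaschke_product_le_2E)
      case (1 \<zeta>)
      then show ?thesis using b \<alpha> by simp
    next
      case (2 \<zeta> a)
      from Moebius_Blaschke_degree_one[OF \<alpha> 2(3,2,4) b] obtain c where
        "norm c = 1" "\<And>z. norm z < 1 \<Longrightarrow> ?m ((F \<circ> f) \<alpha>) ((F \<circ> f) z) = ?m \<alpha> z * c" by blast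
      then have False using F0 by (intro no_const[OF F sub, of c]) simp_all
      then show ?thesis ..
    next
      case (3 \<zeta> a d)
      show ?thesis
      proof (rule Moebius_Blaschke_degree_two[OF \<alpha> 3(3,4,2,5) b])
        fix c assume "norm c = 1" "\<And>z. norm z < 1 \<Longrightarrow> ?m ((F \<circ> f) \<alpha>) ((F \<circ> f) z) = ?m \<alpha> z * c"
        then have False using F0 by (intro no_const[OF F sub, of c]) simp_all
        then show ?thesis ..
      next
        fix c \<beta> assume "norm c = 1" "norm \<beta> < 1"
          "\<And>z. norm z < 1 \<Longrightarrow> ?m ((F \<circ> f) \<alpha>) ((F \<circ> f) z) = ?m \<alpha> z * (c * ?m \<beta> z)"
        then show ?thesis using that F0 by simp
      qed
    qed
    obtain H where fam: "contractive_disc_family D H" and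
      H: "\<And>z. norm z < 1 \<Longrightarrow> z \<noteq> \<alpha> \<Longrightarrow> H (?m \<alpha> z) (\<phi> z) = c * ?m \<beta> z"
      using key[OF F] fac m_nz by auto
    \<comment> \<open>Inverts \<open>c * ?m \<beta>\<close> and then applies
      \<open>?m \<alpha>\<close>. Hence \<open>?m \<alpha> z\<close> is a fixed point of
      \<open>S (H w (\<phi> z))\<close> as a map in \<open>w\<close>.\<close>
    define S where "S w = ?m \<alpha> (?m (- \<beta>) (cnj c * w))" for w
    have cc: "cnj c * c = 1" using unimodular_mult_cnj[OF c] by (simp add: mult.commute)
    have b': "norm (?m (- \<beta>) (cnj c * w)) < 1" if "norm w < 1" for w
      using \<beta> c that by (intro Moebius_function_norm_lt_1) (auto simp: norm_mult)
    have S_hol: "S holomorphic_on ball 0 1"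
    proof -
      have "?m (- \<beta>) \<circ> (\<lambda>w. cnj c * w) holomorphic_on ball 0 1"
        using \<beta> c by (intro holomorphic_on_compose_gen[OF _ Moebius_function_holomorphic] holomorphic_intros) (auto simp: norm_mult)
      then have "?m \<alpha> \<circ> (?m (- \<beta>) \<circ> (\<lambda>w. cnj c * w)) holomorphic_on ball 0 1"
        by (rule holomorphic_on_compose_gen[OF _ Moebius_function_holomorphic[OF \<alpha>]]) (use b' in auto)
      then show ?thesis by (simp add: S_def[abs_def] o_def)
    qed
    have S_ball: "S ` ball 0 1 \<subseteq> ball 0 1" using b' m_lt by (auto simp: S_def)
    have S: "S (c * ?m \<beta> z) = ?m \<alpha> z" if "norm z < 1" for z
      using cc Moebius_function_compose[of "- \<beta>" \<beta> z] \<beta> that by (simp add: S_def mult.assoc[symmetric])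
    obtain G where G: "holomorphic_fun_on G D" "G ` D \<subseteq> ball 0 1"
      "\<And>z w. z \<in> D \<Longrightarrow> norm w < 1 \<Longrightarrow> S (H w z) = w \<Longrightarrow> G z = w"
      using holomorphic_fixed_point[OF D(1) contractive_disc_family_compose[OF fam S_hol S_ball]] by blast
    have G1: "G (\<phi> z) = ?m \<alpha> z" if "norm z < 1" "z \<noteq> \<alpha>" for z
      using that sub H[OF that] S[OF that(1)] m_lt[OF that(1)] by (intro G(3)) auto
    have holG: "(\<lambda>z. G (\<phi> z)) holomorphic_on ball 0 1"
      by (rule holomorphic_fun_on_curve[OF G(1) hol open_ball sub])
    \<comment> \<open>The value of \<open>H\<close> was not identified at
      \<open>z = \<alpha>\<close>, so this point is reached by continuity.\<close>
    have "G (\<phi> \<alpha>) = ?m \<alpha> \<alpha>"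
    proof (rule tendsto_unique[OF trivial_limit_at])
      show "((\<lambda>z. G (\<phi> z)) \<longlongrightarrow> G (\<phi> \<alpha>)) (at \<alpha>)"
        using holomorphic_on_imp_continuous_on[OF holG] \<alpha> by (simp add: continuous_on_eq_continuous_at isCont_def)
      have lim: "(?m \<alpha> \<longlongrightarrow> ?m \<alpha> \<alpha>) (at \<alpha>)"
        using holomorphic_on_imp_continuous_on[OF Moebius_function_holomorphic[OF \<alpha>]] \<alpha>
        by (simp add: continuous_on_eq_continuous_at isCont_def)
      have "\<forall>\<^sub>F z in at \<alpha>. z \<in> ball 0 1 - {\<alpha>}" using \<alpha> by (intro eventually_at_in_open) auto
      then have "\<forall>\<^sub>F z in at \<alpha>. ?m \<alpha> z = G (\<phi> z)"
        by eventually_elim (use G1 in auto)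
      with lim show "((\<lambda>z. G (\<phi> z)) \<longlongrightarrow> ?m \<alpha> \<alpha>) (at \<alpha>)" by (rule Lim_transform_eventually)
    qed
    with G1 have G2: "G (\<phi> z) = ?m \<alpha> z" if "norm z < 1" for z using that by blast
    have "finite_Blaschke_product 1 (G \<circ> \<phi>)"
      unfolding finite_Blaschke_product_def
      using G2 \<alpha> by (intro exI[of _ 1] exI[of _ "\<lambda>_. \<alpha>"]) auto
    moreover have "\<not> (G \<circ> \<phi>) constant_on ball 0 1"
    proof
      assume "(G \<circ> \<phi>) constant_on ball 0 1"
      then have "(G \<circ> \<phi>) z1 = (G \<circ> \<phi>) \<alpha>" using z1 \<alpha> by (auto simp: constant_on_def)
      then show False using G2[OF z1(1)] G2[OF \<alpha>] m_nz[OF z1] by (simp add: Moebius_function_eq_zero)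
    qed
    ultimately show ?thesis
      unfolding l_geodesic_def using hol sub G(1,2) by (intro conjI exI[of _ G]) auto
  qed
  \<comment> \<open>A Blaschke product of degree one leaves only a unimodular constant after
    division by \<open>?m \<alpha>\<close>, which \<open>no_const\<close> excludes.\<close>
  have "\<not> \<phi> ` ball 0 1 \<subseteq> D" if geo2: "l_geodesic 2 D f"
  proof
    assume sub: "\<phi> ` ball 0 1 \<subseteq> D"
    obtain F s where F: "holomorphic_fun_on F D" "F ` D \<subseteq> ball 0 1" and s: "s \<le> 1" "finite_Blaschke_product s (F \<circ> f)"
      using geo2 by (auto simp: l_geodesic_def)
    have b: "norm ((F \<circ> f) \<alpha>) < 1" using F(2) D0 f\<alpha> by auto
    have "s \<le> 2" using s(1) by simp
    with s(2) show False
    proof (cases rule: finite_Blaschke_product_le_2E)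
      case (2 \<zeta> a)
      from Moebius_Blaschke_degree_one[OF \<alpha> 2(3,2,4) b] obtain c where
        "norm c = 1" "\<And>z. norm z < 1 \<Longrightarrow> ?m ((F \<circ> f) \<alpha>) ((F \<circ> f) z) = ?m \<alpha> z * c" by blast
      then show False using f\<alpha> by (intro no_const[OF F sub, of c]) simp_all
    qed (use b \<alpha> s(1) in auto)
  qed
  then show ?thesis using dich geo by blast
qed

end
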